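(* If the pair $(K,\varkappa)$ of real functions of $(u,v)$ is a solution to the system $$(K^2+\varkappa^2)^{\frac14}\,\Delta\ln(K^2+\varkappa^2)^{\frac14}=2K,\qquad (K^2+\varkappa^2)^{\frac14}\,\Delta\arctan\frac{\varkappa}{K}=2\varkappa, \qquad (\ast)$$ then $K$ and $\varkappa$ are given locally (that is, in a neighbourhood of each point) by the formulas $$K=|\alpha|\,\mathrm{Re}\,\alpha,\qquad \varkappa=|\alpha|\,\mathrm{Im}\,\alpha,\qquad \alpha=\frac{-4\,g_1'\,\overline{g_2'}}{(1+g_1\overline{g_2})^2},$$ where $g_1,g_2$ are holomorphic functions of $z=u+\mathrm{i}v$ satisfying at every point $$g_1'g_2'\neq 0,\qquad g_1\overline{g_2}\neq -1.$$ Conversely, any pair $(g_1,g_2)$ of holomorphic functions satisfying $g_1'g_2'\neq 0$ and $g_1\overline{g_2}\neq -1$ at every point generates, by means of the formulas $K=|\alpha|\,\mathrm{Re}\,\alpha$, $\varkappa=|\alpha|\,\mathrm{Im}\,\alpha$ with $\alpha=\frac{-4\,g_1'\,\overline{g_2'}}{(1+g_1\overline{g_2})^2}$, a solution to the system $(\ast)$.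
   Context: Here $(u,v)$ are real coordinates on a domain in $\mathbb{R}^2\cong\mathbb{C}$, $z=u+\mathrm{i}v$, and $\Delta=\partial_u^2+\partial_v^2$. A prime on a holomorphic function denotes the derivative with respect to $z$; a bar denotes complex conjugation. Solutions $(K,\varkappa)$ are pairs of smooth real-valued functions with $K^2+\varkappa^2\neq0$ everywhere. The expression $\arctan\frac{\varkappa}{K}$ is understood as a smooth local branch $Y$ of the argument of $K+\mathrm{i}\varkappa$; that is, writing locally $K=e^{2X}\cos Y$, $\varkappa=e^{2X}\sin Y$ with $X,Y$ smooth and real, the system reads $\Delta X=2e^X\cos Y$, $\Delta Y=2e^X\sin Y$. All considerations are local. *)

theory Defs
  imports "HOL-Complex_Analysis.Complex_Analysis"
begin

(* On an open set S of a finite-dimensional space this is the class C^n. *)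
primrec times_differentiable_on ::
  "nat \<Rightarrow> 'a::real_normed_vector set \<Rightarrow> ('a \<Rightarrow> 'b::real_normed_vector) \<Rightarrow> bool" where
  "times_differentiable_on 0 S f \<longleftrightarrow> continuous_on S f"
| "times_differentiable_on (Suc n) S f \<longleftrightarrow>
     (\<forall>x\<in>S. f differentiable (at x)) \<and>
     (\<forall>v. times_differentiable_on n S (\<lambda>x. frechet_derivative f (at x) v))"

definition smooth_on :: "'a::real_normed_vector set \<Rightarrow> ('a \<Rightarrow> 'b::real_normed_vector) \<Rightarrow> bool" where
  "smooth_on S f \<longleftrightarrow> (\<forall>n. times_differentiable_on n S f)"

(* The point (u, v) of the real plane is the complex number z = u + i v,
   so u = Re z and v = Im z. *)

definition partial_u :: "(complex \<Rightarrow> real) \<Rightarrow> complex \<Rightarrow> real" where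
  "partial_u f z = deriv (\<lambda>t. f (Complex t (Im z))) (Re z)"

definition partial_v :: "(complex \<Rightarrow> real) \<Rightarrow> complex \<Rightarrow> real" where
  "partial_v f z = deriv (\<lambda>t. f (Complex (Re z) t)) (Im z)"

definition laplacian :: "(complex \<Rightarrow> real) \<Rightarrow> complex \<Rightarrow> real" where
  "laplacian f z = partial_u (partial_u f) z + partial_v (partial_v f) z"

(* Y is a smooth branch on U of the argument of K + i \<kappa>;
   this is what arctan (\<kappa> / K) stands for (K may vanish). *)
definition arg_branch_on ::
  "complex set \<Rightarrow> (complex \<Rightarrow> real) \<Rightarrow> (complex \<Rightarrow> real) \<Rightarrow> (complex \<Rightarrow> real) \<Rightarrow> bool" where
  "arg_branch_on U K \<kappa> Y \<longleftrightarrow>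
     smooth_on U Y \<and> (\<forall>z\<in>U. is_Arg (Complex (K z) (\<kappa> z)) (Y z))"

(* Two branches of the argument on a common open set differ by a locally constant
   function, so the second equation does not depend on the branch chosen near p. *)
definition solution_on :: "complex set \<Rightarrow> (complex \<Rightarrow> real) \<Rightarrow> (complex \<Rightarrow> real) \<Rightarrow> bool" where
  "solution_on D K \<kappa> \<longleftrightarrow>
     smooth_on D K \<and> smooth_on D \<kappa> \<and>
     (\<forall>z\<in>D. (K z)\<^sup>2 + (\<kappa> z)\<^sup>2 \<noteq> 0) \<and>
     (\<forall>z\<in>D. ((K z)\<^sup>2 + (\<kappa> z)\<^sup>2) powr (1/4) *
        laplacian (\<lambda>w. ln (((K w)\<^sup>2 + (\<kappa> w)\<^sup>2) powr (1/4))) z = 2 * K z) \<and>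
     (\<forall>p\<in>D. \<exists>U Y. open U \<and> p \<in> U \<and> U \<subseteq> D \<and> arg_branch_on U K \<kappa> Y \<and>
        (\<forall>z\<in>U. ((K z)\<^sup>2 + (\<kappa> z)\<^sup>2) powr (1/4) * laplacian Y z = 2 * \<kappa> z))"

definition alpha :: "(complex \<Rightarrow> complex) \<Rightarrow> (complex \<Rightarrow> complex) \<Rightarrow> complex \<Rightarrow> complex" where
  "alpha g1 g2 z = - 4 * deriv g1 z * cnj (deriv g2 z) / (1 + g1 z * cnj (g2 z))\<^sup>2"

definition admissible_on :: "complex set \<Rightarrow> (complex \<Rightarrow> complex) \<Rightarrow> (complex \<Rightarrow> complex) \<Rightarrow> bool" where
  "admissible_on D g1 g2 \<longleftrightarrow>
     g1 holomorphic_on D \<and> g2 holomorphic_on D \<and>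
     (\<forall>z\<in>D. deriv g1 z * deriv g2 z \<noteq> 0 \<and> g1 z * cnj (g2 z) \<noteq> - 1)"

end

theory Submission
  imports Defs
begin

text \<open>
  Where a smooth branch of the argument of \<open>K + \<i>\<kappa>\<close> exists, let
  \<open>W = X + \<i> Y\<close> be determined by \<open>K = e^{2X} cos Y\<close> and \<open>\<kappa> = e^{2X} sin Y\<close>, so that
  \<open>K + \<i>\<kappa> = \<bar>\<alpha>\<bar> \<alpha>\<close> with \<open>\<alpha> = e^W\<close>. The two equations of the system are the real and the
  imaginary part of \<open>\<Delta>W = 2 e^W\<close>, that is, of the complex Liouville equation
  \<open>W_{z z'} = e^W / 2\<close>, where the subscript \<open>z\<close> denotes the Wirtinger derivative
  \<open>(\<partial>_u - \<i> \<partial>_v) / 2\<close> and \<open>z'\<close> denotes its conjugate \<open>(\<partial>_u + \<i> \<partial>_v) / 2\<close>.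

  From solutions to \<open>g\<^sub>1, g\<^sub>2\<close>: the equation makes the Schwarzian-like expression
  \<open>Q = W_{zz} - W_z^2 / 2\<close> holomorphic, because
  \<open>Q_{z'} = (e^W / 2)_z - W_z e^W / 2 = 0\<close>; this needs the symmetry of mixed second
  derivatives (\<open>wirtinger_commute\<close>). The function \<open>\<phi> = e^{-W/2}\<close> then satisfies the linear
  equation \<open>\<phi>_{zz} = - (Q / 2) \<phi>\<close> with holomorphic coefficient. For a basis \<open>f\<^sub>1, f\<^sub>2\<close> of
  holomorphic solutions (\<open>second_order_linear_ode\<close>) with Wronskian 1, Cramer's rule gives
  \<open>\<phi> = A f\<^sub>1 + B f\<^sub>2\<close>, where \<open>A\<close> and \<open>B\<close> are annihilated by \<open>\<partial>_z\<close>, hence antiholomorphic. The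
  Liouville equation fixes the Wronskian of \<open>A\<close> and \<open>B\<close> to be \<open>-1/4\<close>. Take \<open>g\<^sub>1 = f\<^sub>2 / f\<^sub>1\<close> and
  let \<open>g\<^sub>2\<close> be the conjugate of \<open>B / A\<close>. The quotient rule gives \<open>g\<^sub>1' = 1 / f\<^sub>1\<^sup>2\<close> and
  \<open>cnj g\<^sub>2' = -1 / (4 A\<^sup>2)\<close>, while \<open>1 + g\<^sub>1 cnj g\<^sub>2 = \<phi> / (A f\<^sub>1)\<close>; hence the \<open>\<alpha>\<close> formed from \<open>g\<^sub>1\<close>
  and \<open>g\<^sub>2\<close> is \<open>\<phi>^{-2} = e^W\<close> (\<open>liouville_local_representation\<close>).

  From \<open>g\<^sub>1, g\<^sub>2\<close> to solutions: \<open>\<alpha>\<close> is smooth and has no zeros, so it has local smooth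
  logarithms \<open>W\<close>. Since \<open>W_z\<close> equals \<open>g\<^sub>1'' / g\<^sub>1' - 2 g\<^sub>1' h / (1 + g\<^sub>1 h)\<close> with \<open>h\<close> the conjugate
  of \<open>g\<^sub>2\<close>, applying \<open>\<partial>_{z'}\<close> gives \<open>\<alpha> / 2\<close>, which is the Liouville equation again
  (\<open>log_alpha_liouville\<close>).
\<close>

section \<open>Symmetry of mixed second derivatives\<close>

text \<open>
  The symmetric second difference of \<open>f\<close> along \<open>u\<close> and \<open>v\<close> recovers the second derivative
  taken first along \<open>u\<close> and then along \<open>v\<close>: the mean value theorem in direction \<open>u\<close> turns it into
  a first difference in direction \<open>v\<close> of the directional derivative along \<open>u\<close>, whose
  differentiability at the single point \<open>x\<close> controls the error.
\<close>

lemma second_difference_tendsto: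
  fixes f :: "'a::real_normed_vector \<Rightarrow> real"
  assumes "open U" "x \<in> U"
    and df: "\<And>y. y \<in> U \<Longrightarrow> (f has_derivative f' y) (at y)"
    and L: "((\<lambda>y. f' y u) has_derivative L) (at x)"
  shows "((\<lambda>s. (f (x + s *\<^sub>R u + s *\<^sub>R v) - f (x + s *\<^sub>R u) - f (x + s *\<^sub>R v) + f x) / s\<^sup>2)
           \<longlongrightarrow> L v) (at_right (0::real))"
proof (rule tendstoI)
  fix e :: real assume "e > 0"
  define N where "N = 2 * norm u + norm v + 1"
  have "N > 0" unfolding N_def by (smt (verit) norm_ge_zero)
  define e' where "e' = e / (2 * N)"
  have "e' > 0" using \<open>e > 0\<close> \<open>N > 0\<close> by (simp add: e'_def)
  interpret L: bounded_linear L using L by (rule has_derivative_bounded_linear)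
  obtain r where r: "r > 0" "ball x r \<subseteq> U"
    using \<open>open U\<close> \<open>x \<in> U\<close> open_contains_ball by blast
  obtain d where d: "d > 0"
      "\<And>y. norm (y - x) < d \<Longrightarrow> norm (f' y u - f' x u - L (y - x)) \<le> e' * norm (y - x)"
    using L \<open>e' > 0\<close> unfolding has_derivative_at_alt by metis
  define m where "m = min r d / N"
  have "m > 0" using r d \<open>N > 0\<close> by (simp add: m_def)
  have "dist ((f (x + s *\<^sub>R u + s *\<^sub>R v) - f (x + s *\<^sub>R u) - f (x + s *\<^sub>R v) + f x) / s\<^sup>2) (L v) < e"
    if s: "0 < s" "s < m" for s
  proof -
    have small: "norm (t *\<^sub>R u + c *\<^sub>R v) < r" "norm (t *\<^sub>R u + c *\<^sub>R v) < d"
      if "0 \<le> t" "t \<le> s" "0 \<le> c" "c \<le> s" for t c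
    proof -
      have "norm (t *\<^sub>R u + c *\<^sub>R v) \<le> t * norm u + c * norm v"
        using norm_triangle_ineq[of "t *\<^sub>R u" "c *\<^sub>R v"] that by simp
      also have "\<dots> \<le> s * norm u + s * norm v"
        by (intro add_mono mult_right_mono that) auto
      also have "\<dots> \<le> s * N"
        unfolding N_def using s by (simp add: algebra_simps)
      also have "\<dots> < m * N" using s \<open>N > 0\<close> by simp
      also have "\<dots> = min r d" using \<open>N > 0\<close> by (simp add: m_def)
      finally show "norm (t *\<^sub>R u + c *\<^sub>R v) < r" "norm (t *\<^sub>R u + c *\<^sub>R v) < d" by auto
    qed
    have inU: "x + t *\<^sub>R u + c *\<^sub>R v \<in> U" if "0 \<le> t" "t \<le> s" "0 \<le> c" "c \<le> s" for t c
    proof -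
      have "dist x (x + t *\<^sub>R u + c *\<^sub>R v) = norm (t *\<^sub>R u + c *\<^sub>R v)"
        by (simp add: dist_norm algebra_simps norm_minus_commute)
      with small[OF that] r(2) show ?thesis by auto
    qed
    \<comment> \<open>The second difference is \<open>h s - h 0\<close>.\<close>
    define h where "h t = f (x + t *\<^sub>R u + s *\<^sub>R v) - f (x + t *\<^sub>R u)" for t
    have dh: "(h has_derivative (\<lambda>a. a * (f' (x + t *\<^sub>R u + s *\<^sub>R v) u - f' (x + t *\<^sub>R u) u))) (at t within {0..s})"
      if "0 \<le> t" "t \<le> s" for t
    proof -
      have 1: "((\<lambda>t. f (x + t *\<^sub>R u + c *\<^sub>R v)) has_derivative (\<lambda>a. a * f' (x + t *\<^sub>R u + c *\<^sub>R v) u)) (at t)"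
        if "0 \<le> c" "c \<le> s" for c
      proof -
        have D: "(f has_derivative f' (x + t *\<^sub>R u + c *\<^sub>R v)) (at (x + t *\<^sub>R u + c *\<^sub>R v))"
          using df inU \<open>0 \<le> t\<close> \<open>t \<le> s\<close> that by blast
        interpret D: bounded_linear "f' (x + t *\<^sub>R u + c *\<^sub>R v)" using D by (rule has_derivative_bounded_linear)
        have "((\<lambda>t. x + t *\<^sub>R u + c *\<^sub>R v) has_derivative (\<lambda>a. a *\<^sub>R u)) (at t)"
          by (auto intro!: derivative_eq_intros)
        from has_derivative_compose[OF this D] show ?thesis
          by (simp add: D.scaleR)
      qed
      show ?thesis
        unfolding h_def
        using has_derivative_diff[OF 1[of s] 1[of 0]] s
        by (auto simp: algebra_simps intro: has_derivative_at_withinI)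
    qed
    obtain t where t: "t \<in> {0<..<s}"
      "h s - h 0 = (s - 0) * (f' (x + t *\<^sub>R u + s *\<^sub>R v) u - f' (x + t *\<^sub>R u) u)"
      using mvt_simple[OF s(1) dh] by auto
    define E where "E y = f' y u - f' x u - L (y - x)" for y
    have b1: "\<bar>E (x + t *\<^sub>R u + s *\<^sub>R v)\<bar> \<le> e' * (s * norm u + s * norm v)"
    proof -
      have "\<bar>E (x + t *\<^sub>R u + s *\<^sub>R v)\<bar> \<le> e' * norm (t *\<^sub>R u + s *\<^sub>R v)"
        using d(2)[of "x + t *\<^sub>R u + s *\<^sub>R v"] small(2)[of t s] t s
        by (simp add: E_def add.assoc)
      also have "norm (t *\<^sub>R u + s *\<^sub>R v) \<le> t * norm u + s * norm v"
        using norm_triangle_ineq[of "t *\<^sub>R u" "s *\<^sub>R v"] t s by simp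
      also have "\<dots> \<le> s * norm u + s * norm v" using t by (simp add: mult_right_mono)
      finally show ?thesis using \<open>e' > 0\<close> by simp
    qed
    have b2: "\<bar>E (x + t *\<^sub>R u)\<bar> \<le> e' * (s * norm u)"
    proof -
      have "\<bar>E (x + t *\<^sub>R u)\<bar> \<le> e' * norm (t *\<^sub>R u)"
        using d(2)[of "x + t *\<^sub>R u"] small(2)[of t 0] t s
        by (simp add: E_def)
      also have "norm (t *\<^sub>R u) \<le> s * norm u" using t by (simp add: mult_right_mono)
      finally show ?thesis using \<open>e' > 0\<close> by simp
    qed
    let ?D = "f (x + s *\<^sub>R u + s *\<^sub>R v) - f (x + s *\<^sub>R u) - f (x + s *\<^sub>R v) + f x"
    have "?D = s * (f' (x + t *\<^sub>R u + s *\<^sub>R v) u - f' (x + t *\<^sub>R u) u)"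
      using t(2) by (simp add: h_def algebra_simps)
    also have "\<dots> = s\<^sup>2 * L v + s * (E (x + t *\<^sub>R u + s *\<^sub>R v) - E (x + t *\<^sub>R u))"
      by (simp add: E_def L.add L.scaleR L.diff algebra_simps power2_eq_square)
    finally have D: "?D = s\<^sup>2 * L v + s * (E (x + t *\<^sub>R u + s *\<^sub>R v) - E (x + t *\<^sub>R u))" .
    have "?D / s\<^sup>2 - L v = (E (x + t *\<^sub>R u + s *\<^sub>R v) - E (x + t *\<^sub>R u)) / s"
      unfolding D using s by (simp add: add_divide_distrib power2_eq_square)
    moreover have "\<bar>E (x + t *\<^sub>R u + s *\<^sub>R v) - E (x + t *\<^sub>R u)\<bar> \<le> s * (e' * N)"
    proof -
      have "e' * (s * norm u + s * norm v) + e' * (s * norm u) = s * (e' * N) - s * e'"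
        by (simp add: N_def algebra_simps)
      moreover have "s * e' > 0" using s \<open>e' > 0\<close> by simp
      ultimately show ?thesis using b1 b2 by linarith
    qed
    ultimately have "\<bar>?D / s\<^sup>2 - L v\<bar> \<le> e' * N"
      using s by (simp only: abs_divide) (simp add: field_simps)
    also have "\<dots> < e" using \<open>e > 0\<close> \<open>N > 0\<close> by (simp add: e'_def)
    finally show ?thesis by (simp add: dist_real_def)
  qed
  then show "\<forall>\<^sub>F s in at_right 0. dist ((f (x + s *\<^sub>R u + s *\<^sub>R v) - f (x + s *\<^sub>R u) - f (x + s *\<^sub>R v) + f x) / s\<^sup>2) (L v) < e"
    unfolding eventually_at_right_field using \<open>m > 0\<close> by auto
qed

text \<open>
  The second difference is symmetric in \<open>u\<close> and \<open>v\<close>, so its two descriptions as a limit agree.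
\<close>

lemma mixed_second_derivatives_eq:
  fixes f :: "'a::real_normed_vector \<Rightarrow> real"
  assumes "open U" "x \<in> U"
    and "\<And>y. y \<in> U \<Longrightarrow> (f has_derivative f' y) (at y)"
    and "((\<lambda>y. f' y u) has_derivative L) (at x)"
    and "((\<lambda>y. f' y v) has_derivative M) (at x)"
  shows "L v = M u"
proof (rule tendsto_unique)
  show "((\<lambda>s. (f (x + s *\<^sub>R u + s *\<^sub>R v) - f (x + s *\<^sub>R u) - f (x + s *\<^sub>R v) + f x) / s\<^sup>2)
           \<longlongrightarrow> L v) (at_right 0)"
    by (rule second_difference_tendsto) (use assms in auto)
  have "((\<lambda>s. (f (x + s *\<^sub>R v + s *\<^sub>R u) - f (x + s *\<^sub>R v) - f (x + s *\<^sub>R u) + f x) / s\<^sup>2)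
           \<longlongrightarrow> M u) (at_right 0)"
    by (rule second_difference_tendsto) (use assms in auto)
  then show "((\<lambda>s. (f (x + s *\<^sub>R u + s *\<^sub>R v) - f (x + s *\<^sub>R u) - f (x + s *\<^sub>R v) + f x) / s\<^sup>2)
           \<longlongrightarrow> M u) (at_right 0)"
    by (simp add: algebra_simps)
qed simp

section \<open>Stability properties of smooth functions\<close>

lemma times_differentiable_on_cong:
  assumes "open S" "\<And>x. x \<in> S \<Longrightarrow> f x = g x" "times_differentiable_on n S f"
  shows "times_differentiable_on n S g"
  using assms(2,3)
proof (induction n arbitrary: f g)
  case 0
  then show ?case using continuous_on_cong by (metis times_differentiable_on.simps(1))
next
  case (Suc n)
  have d: "(g has_derivative frechet_derivative f (at x)) (at x)" if "x \<in> S" for x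
    using Suc.prems that \<open>open S\<close> frechet_derivative_works[of f "at x"]
    by (auto intro: has_derivative_transform_within_open)
  have "frechet_derivative f (at x) v = frechet_derivative g (at x) v" if "x \<in> S" for x v
    using frechet_derivative_at[OF d[OF that]] by simp
  then have "times_differentiable_on n S (\<lambda>x. frechet_derivative g (at x) v)" for v
    using Suc.IH[of "\<lambda>x. frechet_derivative f (at x) v" "\<lambda>x. frechet_derivative g (at x) v"]
      Suc.prems(2) by simp
  then show ?case using d by (auto simp: differentiable_def)
qed

lemma times_differentiable_on_SucD:
  "times_differentiable_on (Suc n) S f \<Longrightarrow> times_differentiable_on n S f"
proof (induction n arbitrary: f)
  case 0
  then show ?case
    by (auto intro!: continuous_at_imp_continuous_on differentiable_imp_continuous_within)
next
  case (Suc n)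
  from Suc.prems have 1: "\<forall>x\<in>S. f differentiable (at x)"
    and 2: "\<And>v. times_differentiable_on (Suc n) S (\<lambda>x. frechet_derivative f (at x) v)"
    using times_differentiable_on.simps(2)[of "Suc n" S f] by blast+
  show ?case using 1 Suc.IH[OF 2] by simp
qed

lemma times_differentiable_on_subset:
  "times_differentiable_on n S f \<Longrightarrow> T \<subseteq> S \<Longrightarrow> times_differentiable_on n T f"
  by (induction n arbitrary: f) (auto intro: continuous_on_subset)

text \<open>
  With this rule and the next one, the closure properties below are inductions in which an
  explicit derivative \<open>f'\<close> replaces \<open>frechet_derivative\<close>.
\<close>

lemma times_differentiable_on_SucI:
  assumes "open S" "\<And>x. x \<in> S \<Longrightarrow> (f has_derivative f' x) (at x)"
    "\<And>v. times_differentiable_on n S (\<lambda>x. f' x v)"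
  shows "times_differentiable_on (Suc n) S f"
proof -
  have "times_differentiable_on n S (\<lambda>x. frechet_derivative f (at x) v)" for v
  proof (rule times_differentiable_on_cong[OF assms(1) _ assms(3)])
    show "f' x v = frechet_derivative f (at x) v" if "x \<in> S" for x
      using frechet_derivative_at[OF assms(2)[OF that]] by simp
  qed
  then show ?thesis using assms(2) by (auto simp: differentiable_def)
qed

lemma times_differentiable_on_SucE:
  assumes "times_differentiable_on (Suc n) S f"
  shows "\<And>x. x \<in> S \<Longrightarrow> (f has_derivative frechet_derivative f (at x)) (at x)"
    "\<And>v. times_differentiable_on n S (\<lambda>x. frechet_derivative f (at x) v)"
  using assms frechet_derivative_works by auto

lemma times_differentiable_on_linear:
  assumes "open S" "bounded_linear L" "times_differentiable_on n S f"
  shows "times_differentiable_on n S (\<lambda>x. L (f x))"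
  using assms(3)
proof (induction n arbitrary: f)
  case 0
  then show ?case using assms(2) by (simp add: bounded_linear.continuous_on)
next
  case (Suc n)
  note f = times_differentiable_on_SucE[OF Suc.prems]
  show ?case
    by (rule times_differentiable_on_SucI[OF assms(1) bounded_linear.has_derivative[OF assms(2) f(1)]])
       (use Suc.IH[OF f(2)] in auto)
qed

lemma times_differentiable_on_add:
  assumes "open S" "times_differentiable_on n S f" "times_differentiable_on n S g"
  shows "times_differentiable_on n S (\<lambda>x. f x + g x)"
  using assms(2,3)
proof (induction n arbitrary: f g)
  case 0
  then show ?case by (simp add: continuous_on_add)
next
  case (Suc n)
  note f = times_differentiable_on_SucE[OF Suc.prems(1)]
  note g = times_differentiable_on_SucE[OF Suc.prems(2)]
  show ?case
    by (rule times_differentiable_on_SucI[OF assms(1) has_derivative_add[OF f(1) g(1)]])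
       (use Suc.IH[OF f(2) g(2)] in auto)
qed

lemma times_differentiable_on_mult:
  fixes f g :: "'a::real_normed_vector \<Rightarrow> 'b::real_normed_algebra"
  assumes "open S" "times_differentiable_on n S f" "times_differentiable_on n S g"
  shows "times_differentiable_on n S (\<lambda>x. f x * g x)"
  using assms(2,3)
proof (induction n arbitrary: f g)
  case 0
  then show ?case by (simp add: continuous_on_mult)
next
  case (Suc n)
  note f = times_differentiable_on_SucE[OF Suc.prems(1)]
  note g = times_differentiable_on_SucE[OF Suc.prems(2)]
  show ?case
    by (rule times_differentiable_on_SucI[OF assms(1) has_derivative_mult[OF f(1) g(1)]])
       (auto intro!: times_differentiable_on_add[OF assms(1)] Suc.IH f(2) g(2)
          times_differentiable_on_SucD[OF Suc.prems(1)] times_differentiable_on_SucD[OF Suc.prems(2)])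
qed

text \<open>
  The induction generalises over \<open>h\<close>, since the chain rule brings in \<open>deriv h\<close>. The case where
  \<open>f\<close> is the identity is the smoothness of holomorphic functions.
\<close>

lemma times_differentiable_on_holomorphic_compose:
  assumes "open S" "open T" "h holomorphic_on T" "f ` S \<subseteq> T" "times_differentiable_on n S f"
  shows "times_differentiable_on n S (\<lambda>x. h (f x))"
  using assms(3,4,5)
proof (induction n arbitrary: h)
  case 0
  then show ?case
    using continuous_on_compose2[OF holomorphic_on_imp_continuous_on, of h T S f] by auto
next
  case (Suc n)
  note f = times_differentiable_on_SucE[OF Suc.prems(3)]
  have h: "((\<lambda>x. h (f x)) has_derivative (\<lambda>v. deriv h (f x) * frechet_derivative f (at x) v)) (at x)"
    if "x \<in> S" for x
  proof -
    have "(h has_field_derivative deriv h (f x)) (at (f x))"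
      using Suc.prems that by (intro holomorphic_derivI[OF _ assms(2)]) auto
    from has_derivative_compose[OF f(1)[OF that] this[unfolded has_field_derivative_def]]
    show ?thesis .
  qed
  show ?case
    by (rule times_differentiable_on_SucI[OF assms(1) h])
       (auto intro!: times_differentiable_on_mult[OF assms(1)] f(2) Suc.IH Suc.prems(2)
          holomorphic_deriv Suc.prems(1) assms(2) times_differentiable_on_SucD[OF Suc.prems(3)])
qed

lemma times_differentiable_on_const: "times_differentiable_on n S (\<lambda>x. c)"
  by (induction n arbitrary: c) auto

lemma times_differentiable_on_ident: "times_differentiable_on n S (\<lambda>x. x)"
  by (cases n) (auto intro: times_differentiable_on_const)

lemma smooth_on_cong:
  "open S \<Longrightarrow> (\<And>x. x \<in> S \<Longrightarrow> f x = g x) \<Longrightarrow> smooth_on S f \<Longrightarrow> smooth_on S g"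
  unfolding smooth_on_def using times_differentiable_on_cong by blast

lemma smooth_on_subset: "smooth_on S f \<Longrightarrow> T \<subseteq> S \<Longrightarrow> smooth_on T f"
  unfolding smooth_on_def using times_differentiable_on_subset by blast

lemma smooth_on_linear:
  "open S \<Longrightarrow> bounded_linear L \<Longrightarrow> smooth_on S f \<Longrightarrow> smooth_on S (\<lambda>x. L (f x))"
  unfolding smooth_on_def using times_differentiable_on_linear by blast

lemma smooth_on_add:
  "open S \<Longrightarrow> smooth_on S f \<Longrightarrow> smooth_on S g \<Longrightarrow> smooth_on S (\<lambda>x. f x + g x)"
  unfolding smooth_on_def using times_differentiable_on_add by blast

lemma smooth_on_mult:
  fixes f g :: "'a::real_normed_vector \<Rightarrow> 'b::real_normed_algebra"
  shows "open S \<Longrightarrow> smooth_on S f \<Longrightarrow> smooth_on S g \<Longrightarrow> smooth_on S (\<lambda>x. f x * g x)"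
  unfolding smooth_on_def using times_differentiable_on_mult by blast

lemma smooth_on_const: "smooth_on S (\<lambda>x. c)"
  unfolding smooth_on_def by (simp add: times_differentiable_on_const)

lemma smooth_on_holomorphic_compose:
  "open S \<Longrightarrow> open T \<Longrightarrow> h holomorphic_on T \<Longrightarrow> f ` S \<subseteq> T \<Longrightarrow> smooth_on S f
    \<Longrightarrow> smooth_on S (\<lambda>x. h (f x))"
  unfolding smooth_on_def using times_differentiable_on_holomorphic_compose by blast

lemma smooth_on_holomorphic: "open S \<Longrightarrow> h holomorphic_on S \<Longrightarrow> smooth_on S h"
  using smooth_on_holomorphic_compose[of S S h "\<lambda>x. x"]
  by (simp add: smooth_on_def times_differentiable_on_ident)

lemma smooth_on_local:
  assumes "\<And>x. x \<in> S \<Longrightarrow> \<exists>U. open U \<and> x \<in> U \<and> smooth_on U f"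
  shows "smooth_on S f"
proof -
  have "times_differentiable_on n S f" if "\<And>x. x \<in> S \<Longrightarrow> \<exists>U. open U \<and> x \<in> U \<and> times_differentiable_on n U f" for n
    using that
  proof (induction n arbitrary: f)
    case 0
    show ?case unfolding times_differentiable_on.simps
    proof (intro continuous_at_imp_continuous_on ballI)
      fix x assume "x \<in> S"
      with 0 obtain U where "open U" "x \<in> U" "continuous_on U f" by auto
      then show "isCont f x" using continuous_on_eq_continuous_at by blast
    qed
  next
    case (Suc n)
    then show ?case by fastforce
  qed
  then show ?thesis using assms unfolding smooth_on_def by metis
qed

section \<open>Wirtinger derivatives\<close>

text \<open>
  Every real-linear map of the complex plane has the form \<open>h \<mapsto> a h + b cnj h\<close>, and for the
  derivative of \<open>F\<close> the coefficients \<open>a\<close> and \<open>b\<close> are the two Wirtinger derivatives of \<open>F\<close>.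
  As a relation this combines differentiability with the values of the derivatives, so
  that rules can be composed in the manner of \<open>has_field_derivative\<close>.
\<close>

definition has_wirtinger :: "(complex \<Rightarrow> complex) \<Rightarrow> complex \<Rightarrow> complex \<Rightarrow> complex \<Rightarrow> bool" where
  "has_wirtinger F a b z \<longleftrightarrow> (F has_derivative (\<lambda>h. a * h + b * cnj h)) (at z)"

lemma has_wirtinger_unique:
  assumes "has_wirtinger F a b z" "has_wirtinger F a' b' z"
  shows "a = a'" "b = b'"
proof -
  have "(\<lambda>h. a * h + b * cnj h) = (\<lambda>h. a' * h + b' * cnj h)"
    using assms has_derivative_unique unfolding has_wirtinger_def by blast
  from fun_cong[OF this, of 1] fun_cong[OF this, of \<i>]
  have "a + b = a' + b'" "\<i> * (a - b) = \<i> * (a' - b')" by (simp_all add: algebra_simps)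
  then have "a + b = a' + b'" "a - b = a' - b'" by simp_all
  then show "a = a'" "b = b'" by (auto simp: complex_eq_iff)
qed

lemma has_wirtinger_add:
  assumes "has_wirtinger F a b z" "has_wirtinger G c d z"
  shows "has_wirtinger (\<lambda>w. F w + G w) (a + c) (b + d) z"
  using has_derivative_add[OF assms[unfolded has_wirtinger_def]]
  unfolding has_wirtinger_def by (simp add: algebra_simps)

lemma has_wirtinger_diff:
  assumes "has_wirtinger F a b z" "has_wirtinger G c d z"
  shows "has_wirtinger (\<lambda>w. F w - G w) (a - c) (b - d) z"
  using has_derivative_diff[OF assms[unfolded has_wirtinger_def]]
  unfolding has_wirtinger_def by (simp add: algebra_simps)

lemma has_wirtinger_mult:
  assumes "has_wirtinger F a b z" "has_wirtinger G c d z"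
  shows "has_wirtinger (\<lambda>w. F w * G w) (a * G z + F z * c) (b * G z + F z * d) z"
  using has_derivative_mult[OF assms[unfolded has_wirtinger_def]]
  unfolding has_wirtinger_def by (simp add: algebra_simps)

text \<open>
  The Cauchy--Riemann equations: complex differentiability is the vanishing of the second
  Wirtinger derivative.
\<close>

lemma has_wirtinger_holomorphic:
  "has_wirtinger F a 0 z \<longleftrightarrow> (F has_field_derivative a) (at z)"
  unfolding has_wirtinger_def has_field_derivative_def by simp

lemma has_wirtinger_cnj:
  assumes "has_wirtinger F a b z"
  shows "has_wirtinger (\<lambda>w. cnj (F w)) (cnj b) (cnj a) z"
  using has_derivative_cnj[OF assms[unfolded has_wirtinger_def]]
  unfolding has_wirtinger_def by (simp add: algebra_simps)

lemma has_wirtinger_const: "has_wirtinger (\<lambda>w. c) 0 0 z"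
  by (simp add: has_wirtinger_holomorphic)

lemma has_wirtinger_cmult:
  assumes "has_wirtinger F a b z"
  shows "has_wirtinger (\<lambda>w. c * F w) (c * a) (c * b) z"
  using has_wirtinger_mult[OF has_wirtinger_const assms, of c] by simp

lemma has_wirtinger_compose:
  assumes "has_wirtinger F a b z" "(h has_field_derivative h') (at (F z))"
  shows "has_wirtinger (\<lambda>w. h (F w)) (h' * a) (h' * b) z"
  using has_derivative_compose[OF assms(1)[unfolded has_wirtinger_def] assms(2)[unfolded has_field_derivative_def]]
  unfolding has_wirtinger_def by (simp add: algebra_simps)

lemma has_wirtinger_cong:
  assumes "has_wirtinger F a b z" "open U" "z \<in> U" "\<And>w. w \<in> U \<Longrightarrow> F w = G w"
  shows "has_wirtinger G a b z"
  using assms unfolding has_wirtinger_def by (blast intro: has_derivative_transform_within_open)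

text \<open>
  Symmetry of the real second derivatives of \<open>Re F\<close> along \<open>1\<close> and \<open>\<i>\<close> yields the equality of the
  imaginary parts; applied to \<open>\<i> F\<close> it yields that of the real parts.
\<close>

lemma wirtinger_commute:
  assumes "open U" "z \<in> U"
    and F: "\<And>w. w \<in> U \<Longrightarrow> has_wirtinger F (P w) (R w) w"
    and P: "has_wirtinger P P1 P2 z" and R: "has_wirtinger R R1 R2 z"
  shows "P2 = R1"
proof -
  have Im_eq: "Im P2 = Im R1"
    if F: "\<And>w. w \<in> U \<Longrightarrow> has_wirtinger F (P w) (R w) w"
    and P: "has_wirtinger P P1 P2 z" and R: "has_wirtinger R R1 R2 z" for F P R P1 P2 R1 R2
  proof -
    have dF: "((\<lambda>w. Re (F w)) has_derivative (\<lambda>h. Re (P w * h + R w * cnj h))) (at w)" if "w \<in> U" for w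
      using has_derivative_Re[OF F[OF that, unfolded has_wirtinger_def]] .
    have dP: "((\<lambda>y. Re (P y * u + R y * cnj u)) has_derivative
         (\<lambda>h. Re ((P1 * h + P2 * cnj h) * u + (R1 * h + R2 * cnj h) * cnj u))) (at z)" for u
      using P R unfolding has_wirtinger_def
      by (intro has_derivative_Re has_derivative_add has_derivative_mult_left)
    from mixed_second_derivatives_eq[OF assms(1,2) dF dP[of 1] dP[of \<i>]]
    show ?thesis by (simp add: algebra_simps)
  qed
  have 1: "Im P2 = Im R1" by (rule Im_eq[OF F P R])
  have "Im (\<i> * P2) = Im (\<i> * R1)"
    by (rule Im_eq) (use has_wirtinger_cmult F P R in blast)+
  with 1 show ?thesis by (simp add: complex_eq_iff)
qed

section \<open>The Laplacian in Wirtinger derivatives\<close>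

lemma smooth_on_imp_has_wirtinger:
  assumes "open U" "smooth_on U F"
  obtains P R where "smooth_on U P" "smooth_on U R" "\<And>z. z \<in> U \<Longrightarrow> has_wirtinger F (P z) (R z) z"
proof -
  define D where "D v z = frechet_derivative F (at z) v" for v z
  have F: "times_differentiable_on (Suc n) U F" for n using assms by (simp add: smooth_on_def)
  have D: "smooth_on U (D v)" for v
    unfolding smooth_on_def D_def using times_differentiable_on_SucE(2)[OF F] by blast
  define P where "P z = 1 / 2 * (D 1 z + (- \<i>) * D \<i> z)" for z
  define R where "R z = 1 / 2 * (D 1 z + \<i> * D \<i> z)" for z
  have "smooth_on U P" "smooth_on U R"
    unfolding P_def R_def
    by (intro smooth_on_mult smooth_on_const smooth_on_add D assms(1))+
  moreover have "has_wirtinger F (P z) (R z) z" if "z \<in> U" for z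
  proof -
    have d: "(F has_derivative (\<lambda>v. D v z)) (at z)"
      unfolding D_def using times_differentiable_on_SucE(1)[OF F that] .
    interpret bounded_linear "\<lambda>v. D v z" using d by (rule has_derivative_bounded_linear)
    have "D h z = P z * h + R z * cnj h" for h
    proof -
      have "D h z = D (Re h *\<^sub>R 1 + Im h *\<^sub>R \<i>) z"
        by (rule arg_cong[of _ _ "\<lambda>h. D h z"]) (simp add: complex_eq_iff)
      also have "\<dots> = Re h *\<^sub>R D 1 z + Im h *\<^sub>R D \<i> z" by (simp only: add scaleR)
      also have "\<dots> = P z * h + R z * cnj h"
        unfolding P_def R_def by (simp add: complex_eq_iff) (simp add: field_simps)
      finally show ?thesis .
    qed
    then show ?thesis using d unfolding has_wirtinger_def by simp
  qed
  ultimately show ?thesis by (rule that)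
qed

text \<open>
  Substituting \<open>\<partial>_u = \<partial>_z + \<partial>_{z'}\<close> and \<open>\<partial>_v = \<i> (\<partial>_z - \<partial>_{z'})\<close> into \<open>\<partial>_u\<^sup>2 + \<partial>_v\<^sup>2\<close> cancels the
  pure second derivatives and leaves \<open>2 (\<partial>_z \<partial>_{z'} + \<partial>_{z'} \<partial>_z)\<close>.
\<close>

lemma laplacian_Re_eq:
  assumes "open U" "z \<in> U" "\<And>w. w \<in> U \<Longrightarrow> f w = Re (F w)"
    and F: "\<And>w. w \<in> U \<Longrightarrow> has_wirtinger F (P w) (R w) w"
    and P: "has_wirtinger P P1 P2 z" and R: "has_wirtinger R R1 R2 z"
  shows "laplacian f z = 2 * Re (P2 + R1)"
proof -
  have pu: "partial_u g w = Re (a + b)" and pv: "partial_v g w = Re (\<i> * (a - b))"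
    if "w \<in> U" "\<And>w. w \<in> U \<Longrightarrow> g w = Re (G w)" "has_wirtinger G a b w" for g G a b w
  proof -
    have "((\<lambda>w. Re (G w)) has_derivative (\<lambda>h. Re (a * h + b * cnj h))) (at w)"
      using has_derivative_Re[OF that(3)[unfolded has_wirtinger_def]] .
    then have "(g has_derivative (\<lambda>h. Re (a * h + b * cnj h))) (at w)"
      by (rule has_derivative_transform_within_open[OF _ assms(1) that(1)]) (simp add: that(2))
    then have g: "(g has_derivative (\<lambda>h. Re (a * h + b * cnj h))) (at (Complex (Re w) (Im w)))"
      by simp
    have "((\<lambda>t. Complex t (Im w)) has_derivative (\<lambda>h. Complex h 0)) (at (Re w))"
      unfolding complex_of_real_mult_Complex Complex_eq by (auto intro!: derivative_eq_intros)
    from has_derivative_compose[OF this g]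
    have "((\<lambda>t. g (Complex t (Im w))) has_real_derivative Re (a + b)) (at (Re w))"
      unfolding has_field_derivative_def by (rule has_derivative_eq_rhs) (simp add: fun_eq_iff algebra_simps)
    then show "partial_u g w = Re (a + b)" unfolding partial_u_def by (rule DERIV_imp_deriv)
    have "((\<lambda>t. Complex (Re w) t) has_derivative (\<lambda>h. Complex 0 h)) (at (Im w))"
      unfolding Complex_eq by (auto intro!: derivative_eq_intros)
    from has_derivative_compose[OF this g]
    have "((\<lambda>t. g (Complex (Re w) t)) has_real_derivative Re (\<i> * (a - b))) (at (Im w))"
      unfolding has_field_derivative_def by (rule has_derivative_eq_rhs) (simp add: fun_eq_iff algebra_simps)
    then show "partial_v g w = Re (\<i> * (a - b))" unfolding partial_v_def by (rule DERIV_imp_deriv)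
  qed
  have "partial_u (partial_u f) z = Re ((P1 + R1) + (P2 + R2))"
    by (rule pu[OF assms(2) pu[OF _ assms(3) F]]) (auto intro: has_wirtinger_add P R)
  moreover have "partial_v (partial_v f) z = Re (\<i> * (\<i> * (P1 - R1) - \<i> * (P2 - R2)))"
  proof (rule pv[OF assms(2)])
    show "partial_v f w = Re (\<i> * (P w - R w))" if "w \<in> U" for w
      using pv[OF that assms(3) F] that by blast
  qed (intro has_wirtinger_cmult has_wirtinger_diff P R)
  ultimately show ?thesis by (simp add: laplacian_def)
qed

lemma laplacian_Im_eq:
  assumes "open U" "z \<in> U" "\<And>w. w \<in> U \<Longrightarrow> f w = Im (F w)"
    and F: "\<And>w. w \<in> U \<Longrightarrow> has_wirtinger F (P w) (R w) w"
    and P: "has_wirtinger P P1 P2 z" and R: "has_wirtinger R R1 R2 z"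
  shows "laplacian f z = 2 * Im (P2 + R1)"
proof -
  have "laplacian f z = 2 * Re (- \<i> * P2 + - \<i> * R1)"
    by (rule laplacian_Re_eq[where F = "\<lambda>w. - \<i> * F w", OF assms(1,2) _
          has_wirtinger_cmult[OF F] has_wirtinger_cmult[OF P] has_wirtinger_cmult[OF R]])
       (simp_all add: assms(3))
  then show ?thesis by simp
qed

text \<open>
  For smooth \<open>W\<close> the two mixed derivatives agree, so that \<open>\<Delta>W = 4 W_{z z'}\<close> can be read off
  from the derivative of \<open>W_z\<close> alone. The function \<open>R\<close> is only known pointwise; its
  differentiability comes from its agreement with a smooth \<open>R'\<close>.
\<close>

lemma laplacian_smooth_eq:
  assumes U: "open U" "z \<in> U" and W: "smooth_on U W" "\<And>w. w \<in> U \<Longrightarrow> has_wirtinger W (P w) (R w) w"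
    and P: "has_wirtinger P P1 P2 z"
  shows "(\<And>w. w \<in> U \<Longrightarrow> f w = Re (W w)) \<Longrightarrow> laplacian f z = 4 * Re P2"
    and "(\<And>w. w \<in> U \<Longrightarrow> f w = Im (W w)) \<Longrightarrow> laplacian f z = 4 * Im P2"
proof -
  obtain P' R' where "smooth_on U R'" and W': "\<And>w. w \<in> U \<Longrightarrow> has_wirtinger W (P' w) (R' w) w"
    using smooth_on_imp_has_wirtinger[OF U(1) W(1)] by metis
  then obtain R1 R2 where "has_wirtinger R' (R1 z) (R2 z) z"
    using smooth_on_imp_has_wirtinger[OF U(1)] U(2) by metis
  then have R: "has_wirtinger R (R1 z) (R2 z) z"
    by (rule has_wirtinger_cong[OF _ U]) (use has_wirtinger_unique(2) W(2) W' in metis)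
  have "P2 = R1 z" by (rule wirtinger_commute[OF U W(2) P R])
  then show "(\<And>w. w \<in> U \<Longrightarrow> f w = Re (W w)) \<Longrightarrow> laplacian f z = 4 * Re P2"
    and "(\<And>w. w \<in> U \<Longrightarrow> f w = Im (W w)) \<Longrightarrow> laplacian f z = 4 * Im P2"
    using laplacian_Re_eq[OF U _ W(2) P R] laplacian_Im_eq[OF U _ W(2) P R] by simp_all
qed

section \<open>Linear differential equations with holomorphic coefficients\<close>

text \<open>
  The Taylor coefficients of the solution of \<open>f'' = q f\<close> with \<open>f = a\<close> and \<open>f' = b\<close> at the centre,
  where \<open>c\<close> lists the Taylor coefficients of \<open>q\<close>.
\<close>

fun ode_coeff :: "(nat \<Rightarrow> complex) \<Rightarrow> complex \<Rightarrow> complex \<Rightarrow> nat \<Rightarrow> complex" where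
  "ode_coeff c a b 0 = a"
| "ode_coeff c a b (Suc 0) = b"
| "ode_coeff c a b (Suc (Suc n)) =
     (\<Sum>k\<le>n. c k * ode_coeff c a b (n - k)) / (of_nat (n + 1) * of_nat (n + 2))"

text \<open>
  The convolution defining coefficient \<open>n + 2\<close> has only \<open>n + 1\<close> terms, which the denominator
  \<open>(n + 1) (n + 2)\<close> absorbs. What remains is the factor \<open>M \<rho>\<^sup>2\<close>, so a geometric bound
  propagates as soon as \<open>\<rho>\<close> is small enough.
\<close>

lemma ode_coeff_bound:
  assumes c: "\<And>k. norm (c k) * \<rho> ^ k \<le> M" and \<rho>: "0 < \<rho>" "M * \<rho>\<^sup>2 \<le> 1"
  shows "norm (ode_coeff c a b n) * \<rho> ^ n \<le> norm a + norm b * \<rho>"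
proof (induction n rule: less_induct)
  case (less n)
  define C where "C = norm a + norm b * \<rho>"
  have "C \<ge> 0" using \<rho> by (simp add: C_def)
  have "M \<ge> 0" using c[of 0] by (smt (verit) norm_ge_zero mult_nonneg_nonneg power_0 zero_le_one)
  consider "n = 0" | "n = Suc 0" | m where "n = Suc (Suc m)"
    by (metis not0_implies_Suc)
  then show ?case
  proof cases
    case 3
    have "norm (\<Sum>k\<le>m. c k * ode_coeff c a b (m - k)) * \<rho> ^ m
          \<le> (\<Sum>k\<le>m. norm (c k) * norm (ode_coeff c a b (m - k))) * \<rho> ^ m"
      using \<rho> by (intro mult_right_mono) (auto intro!: sum_norm_le simp: norm_mult)
    also have "\<dots> = (\<Sum>k\<le>m. (norm (c k) * \<rho> ^ k) * (norm (ode_coeff c a b (m - k)) * \<rho> ^ (m - k)))"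
      unfolding sum_distrib_right
      by (intro sum.cong refl) (simp add: power_add[symmetric] mult_ac)
    also have "\<dots> \<le> (\<Sum>k\<le>m. M * C)"
      using less 3 c \<rho> \<open>M \<ge> 0\<close> unfolding C_def by (intro sum_mono mult_mono) auto
    also have "\<dots> = (real m + 1) * (M * C)" by simp
    finally have 1: "norm (\<Sum>k\<le>m. c k * ode_coeff c a b (m - k)) * \<rho> ^ m \<le> (real m + 1) * (M * C)" .
    have nn: "cmod (1 + of_nat m) = real m + 1" "cmod (2 + of_nat m) = real m + 2"
      using norm_of_nat[of "m + 1", where 'a = complex] norm_of_nat[of "m + 2", where 'a = complex]
      by (simp_all add: add_ac)
    have "norm (ode_coeff c a b n) * \<rho> ^ n
        = (norm (\<Sum>k\<le>m. c k * ode_coeff c a b (m - k)) * \<rho> ^ m) * \<rho>\<^sup>2 / ((real m + 1) * (real m + 2))"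
      unfolding 3 using nn by (simp add: norm_divide norm_mult power2_eq_square)
    also have "\<dots> \<le> ((real m + 1) * (M * C)) * \<rho>\<^sup>2 / ((real m + 1) * (real m + 2))"
      using 1 by (intro divide_right_mono mult_right_mono) auto
    also have "\<dots> = (M * \<rho>\<^sup>2) * C / (real m + 2)"
      by (simp add: divide_simps)
    also have "\<dots> \<le> 1 * C / 1"
      using \<rho> \<open>C \<ge> 0\<close> by (intro frac_le mult_right_mono) auto
    finally show ?thesis by (simp add: C_def)
  qed (use \<rho> in auto)
qed

text \<open>
  The power series with coefficients \<open>ode_coeff\<close> solves the equation formally, and the bound
  on the coefficients makes it converge. The radius depends on \<open>q\<close> only, so that solutions
  with different initial values live on a common disc.
\<close>

lemma second_order_linear_ode:
  assumes "open U" "p \<in> U" "q holomorphic_on U"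
  obtains r where "r > 0" "ball p r \<subseteq> U"
    "\<And>a b. \<exists>f f'. f p = a \<and> f' p = b \<and>
       (\<forall>z\<in>ball p r. (f has_field_derivative f' z) (at z) \<and>
                     (f' has_field_derivative q z * f z) (at z))"
proof -
  define F where "F = fps_expansion q p"
  have F: "(\<lambda>z. q (p + z)) has_fps_expansion F"
    unfolding F_def by (rule analytic_at_imp_has_fps_expansion)
       (use assms analytic_at in blast)
  then have "fps_conv_radius F > 0" and ev: "eventually (\<lambda>z. eval_fps F z = q (p + z)) (nhds 0)"
    by (auto simp: has_fps_expansion_def)
  obtain r1 where r1: "r1 > 0" "\<And>z. norm z < r1 \<Longrightarrow> eval_fps F z = q (p + z)"
    using ev by (auto simp: eventually_nhds_metric)
  obtain r2 where r2: "r2 > 0" "ball p r2 \<subseteq> U" using assms open_contains_ball by blast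
  obtain r3 where r3: "r3 > 0" "ereal r3 < fps_conv_radius F"
    using ereal_dense2[OF \<open>fps_conv_radius F > 0\<close>] by (auto simp: zero_ereal_def)
  have "summable (\<lambda>n. fps_nth F n * of_real r3 ^ n)"
    using r3 by (intro summable_fps) auto
  then have "Bseq (\<lambda>n. fps_nth F n * of_real r3 ^ n)"
    by (intro convergent_imp_Bseq summable_imp_convergent)
  then obtain M where M: "M > 0" "\<And>n. norm (fps_nth F n) * r3 ^ n \<le> M"
    using r3 by (auto simp: Bseq_def norm_mult norm_power)
  define r where "r = Min {r1, r2, r3, 1 / (M + 1)}"
  have "r > 0" "r \<le> r1" "r \<le> r2" "r \<le> r3" "r \<le> 1 / (M + 1)"
    using r1 r2 r3 M by (auto simp: r_def)
  have "M * r\<^sup>2 \<le> M * (1 / (M + 1))\<^sup>2"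
    using M \<open>r > 0\<close> \<open>r \<le> 1 / (M + 1)\<close> by (intro mult_left_mono power_mono) auto
  also have "\<dots> = M / ((M + 1) * (M + 1))" by (simp add: power2_eq_square)
  also have "\<dots> \<le> 1"
    using M mult_mono[of 1 "M + 1" M "M + 1"] by simp
  finally have Mr: "M * r\<^sup>2 \<le> 1" .
  have Fr: "norm (fps_nth F n) * r ^ n \<le> M" for n
  proof -
    have "norm (fps_nth F n) * r ^ n \<le> norm (fps_nth F n) * r3 ^ n"
      using \<open>r > 0\<close> \<open>r \<le> r3\<close> by (intro mult_left_mono power_mono) auto
    then show ?thesis using M(2)[of n] by linarith
  qed
  have ex: "\<exists>f f'. f p = a \<and> f' p = b \<and>
       (\<forall>z\<in>ball p r. (f has_field_derivative f' z) (at z) \<and>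
                     (f' has_field_derivative q z * f z) (at z))" for a b
  proof -
    define A where "A = Abs_fps (ode_coeff (fps_nth F) a b)"
    have "conv_radius (fps_nth A) \<ge> ereal r"
    proof (rule conv_radius_geI_ex')
      fix s assume s: "0 < s" "ereal s < ereal r"
      have "summable (\<lambda>n. norm (fps_nth A n) * s ^ n)"
        by (rule Abel_lemma[of s r]) (use s ode_coeff_bound[OF Fr \<open>r > 0\<close> Mr] in \<open>auto simp: A_def\<close>)
      show "summable (\<lambda>n. fps_nth A n * of_real s ^ n)"
      proof (rule summable_norm_cancel)
        have "norm (fps_nth A n * of_real s ^ n) = norm (fps_nth A n) * s ^ n" for n
          unfolding norm_mult norm_power norm_of_real using s(1) by simp
        then show "summable (\<lambda>n. norm (fps_nth A n * of_real s ^ n))"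
          using \<open>summable (\<lambda>n. norm (fps_nth A n) * s ^ n)\<close> by presburger
      qed
    qed
    then have A: "fps_conv_radius A \<ge> ereal r" by (simp add: fps_conv_radius_def)
    have A': "fps_conv_radius (fps_deriv A) \<ge> ereal r"
      using A fps_conv_radius_deriv[of A] by (rule order_trans)
    have A2: "fps_deriv (fps_deriv A) = F * A"
    proof (rule fps_ext)
      fix n
      have nz: "complex_of_nat (n + 1) \<noteq> 0" "complex_of_nat (n + 2) \<noteq> 0"
        by (metis add_is_0 one_neq_zero zero_neq_numeral of_nat_eq_0_iff)+
      have "fps_nth (fps_deriv (fps_deriv A)) n = of_nat (n + 1) * (of_nat (n + 2) * fps_nth A (Suc (Suc n)))"
        by simp
      also have "\<dots> = (\<Sum>k\<le>n. fps_nth F k * fps_nth A (n - k))"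
        using nz unfolding A_def by (simp del: of_nat_add of_nat_Suc)
      also have "\<dots> = fps_nth (F * A) n" by (simp add: fps_mult_nth atLeast0AtMost)
      finally show "fps_nth (fps_deriv (fps_deriv A)) n = fps_nth (F * A) n" .
    qed
    have inside: "ereal (norm (z - p)) < fps_conv_radius A"
        "ereal (norm (z - p)) < fps_conv_radius (fps_deriv A)"
        "ereal (norm (z - p)) < fps_conv_radius F"
      if "z \<in> ball p r" for z
    proof -
      have zr: "ereal (norm (z - p)) < ereal r" using that by (simp add: dist_norm norm_minus_commute)
      show "ereal (norm (z - p)) < fps_conv_radius A" by (rule less_le_trans[OF zr A])
      show "ereal (norm (z - p)) < fps_conv_radius (fps_deriv A)" by (rule less_le_trans[OF zr A'])
      have "ereal r \<le> ereal r3" using \<open>r \<le> r3\<close> by simp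
      then show "ereal (norm (z - p)) < fps_conv_radius F"
        using zr r3(2) by (meson less_le_trans less_trans)
    qed
    have shift: "((\<lambda>z. z - p) has_field_derivative 1) (at z)" for z
      by (auto intro!: derivative_eq_intros)
    have d1: "((\<lambda>z. eval_fps A (z - p)) has_field_derivative eval_fps (fps_deriv A) (z - p)) (at z)"
      if "z \<in> ball p r" for z
      using DERIV_chain2[OF has_field_derivative_eval_fps[OF inside(1)[OF that]] shift] by simp
    have d2: "((\<lambda>z. eval_fps (fps_deriv A) (z - p)) has_field_derivative q z * eval_fps A (z - p)) (at z)"
      if "z \<in> ball p r" for z
    proof -
      have "eval_fps (fps_deriv (fps_deriv A)) (z - p) = eval_fps F (z - p) * eval_fps A (z - p)"
        unfolding A2 using inside[OF that] by (intro eval_fps_mult) auto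
      also have "eval_fps F (z - p) = q z"
        using r1(2)[of "z - p"] that \<open>r \<le> r1\<close> by (simp add: dist_norm norm_minus_commute)
      finally have "eval_fps (fps_deriv (fps_deriv A)) (z - p) = q z * eval_fps A (z - p)" .
      then show ?thesis
        using DERIV_chain2[OF has_field_derivative_eval_fps[OF inside(2)[OF that]] shift] by simp
    qed
    show ?thesis
      by (rule exI[of _ "\<lambda>z. eval_fps A (z - p)"], rule exI[of _ "\<lambda>z. eval_fps (fps_deriv A) (z - p)"])
         (use d1 d2 in \<open>auto simp: eval_fps_at_0 A_def\<close>)
  qed
  show ?thesis
    by (rule that[OF \<open>r > 0\<close> _ ex]) (use r2 \<open>r \<le> r2\<close> in auto)
qed

section \<open>The complex Liouville equation\<close>

text \<open>
  General local solution of \<open>W_{z z'} = e^W / 2\<close> by reduction to the linear equation satisfied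
  by \<open>\<phi> = e^{-W/2}\<close>. In the proof, \<open>P\<close> is \<open>W_z\<close>, \<open>P1\<close> is \<open>W_{zz}\<close>, and the index \<open>b\<close> marks
  derivatives with respect to \<open>z'\<close>.
\<close>

lemma liouville_local_representation:
  assumes U: "open U" "p \<in> U"
    and W: "\<And>z. z \<in> U \<Longrightarrow> has_wirtinger W (P z) (R z) z"
    and P: "\<And>z. z \<in> U \<Longrightarrow> has_wirtinger P (P1 z) (exp (W z) / 2) z"
    and P1: "\<And>z. z \<in> U \<Longrightarrow> \<exists>a b. has_wirtinger P1 a b z"
  obtains V g1 g2 where "open V" "p \<in> V" "V \<subseteq> U" "admissible_on V g1 g2"
    "\<And>z. z \<in> V \<Longrightarrow> alpha g1 g2 z = exp (W z)"
proof -
  define Q where "Q z = P1 z - 1 / 2 * (P z * P z)" for z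
  have "\<exists>d. (Q has_field_derivative d) (at z)" if z: "z \<in> U" for z
  proof -
    obtain a b where ab: "has_wirtinger P1 a b z" using P1 z by blast
    have half_exp: "has_wirtinger (\<lambda>z. exp (W z) / 2) (exp (W z) / 2 * P z) (exp (W z) / 2 * R z) z"
      by (rule has_wirtinger_compose[OF W[OF z]]) (auto intro!: derivative_eq_intros)
    \<comment> \<open>\<open>W_{zzz'} = (W_{zz'})_z\<close>, and the right-hand side is known from the equation.\<close>
    have "b = exp (W z) / 2 * P z"
      by (rule wirtinger_commute[OF U(1) z P ab half_exp])
    moreover have "has_wirtinger Q (a - 1 / 2 * (P1 z * P z + P z * P1 z))
        (b - 1 / 2 * (exp (W z) / 2 * P z + P z * (exp (W z) / 2))) z"
      unfolding Q_def by (intro has_wirtinger_diff has_wirtinger_cmult has_wirtinger_mult ab P z)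
    ultimately have "has_wirtinger Q (a - 1 / 2 * (P1 z * P z + P z * P1 z)) 0 z"
      by (simp add: field_simps)
    then show ?thesis unfolding has_wirtinger_holomorphic by blast
  qed
  then have "(\<lambda>z. - 1 / 2 * Q z) holomorphic_on U"
    using U(1) by (intro holomorphic_intros) (simp_all add: holomorphic_on_open)
  from second_order_linear_ode[OF U this]
  obtain r where r: "r > 0" "ball p r \<subseteq> U" and ode:
    "\<And>a b. \<exists>f f'. f p = a \<and> f' p = b \<and>
       (\<forall>z\<in>ball p r. (f has_field_derivative f' z) (at z) \<and>
                     (f' has_field_derivative - 1 / 2 * Q z * f z) (at z))"
    by blast
  let ?disc = "ball p r"
  \<comment> \<open>These initial values give Wronskian 1 and, at \<open>p\<close>, the coefficient \<open>A p = \<phi> p\<close>, which is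
     nonzero; so division by \<open>A f\<^sub>1\<close> is possible near \<open>p\<close>.\<close>
  obtain f1 f1' where f1: "f1 p = 1" "f1' p = 0"
     "\<And>z. z \<in> ?disc \<Longrightarrow> (f1 has_field_derivative f1' z) (at z)"
     "\<And>z. z \<in> ?disc \<Longrightarrow> (f1' has_field_derivative - 1 / 2 * Q z * f1 z) (at z)"
    using ode[of 1 0] by blast
  obtain f2 f2' where f2: "f2 p = 0" "f2' p = 1"
     "\<And>z. z \<in> ?disc \<Longrightarrow> (f2 has_field_derivative f2' z) (at z)"
     "\<And>z. z \<in> ?disc \<Longrightarrow> (f2' has_field_derivative - 1 / 2 * Q z * f2 z) (at z)"
    using ode[of 0 1] by blast
  have wronskian: "f1 z * f2' z - f1' z * f2 z = 1" if z: "z \<in> ?disc" for z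
  proof -
    have "((\<lambda>z. f1 z * f2' z - f1' z * f2 z) has_field_derivative 0) (at z within ?disc)" if "z \<in> ?disc" for z
      using f1(3,4)[OF that] f2(3,4)[OF that]
      by (auto intro!: derivative_eq_intros intro: has_field_derivative_at_within simp: algebra_simps)
    from has_field_derivative_zero_constant[OF convex_ball this]
    obtain c where c: "\<forall>z\<in>?disc. f1 z * f2' z - f1' z * f2 z = c" by blast
    have "p \<in> ?disc" using r by simp
    with c z have "f1 z * f2' z - f1' z * f2 z = f1 p * f2' p - f1' p * f2 p" by metis
    then show ?thesis using f1(1,2) f2(1,2) by simp
  qed
  define \<phi> where "\<phi> z = exp (- 1 / 2 * W z)" for z
  define \<psi> where "\<psi> z = - 1 / 2 * (P z * \<phi> z)" for z
  define \<phi>\<^sub>b where "\<phi>\<^sub>b z = - 1 / 2 * (R z * \<phi> z)" for z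
  have \<phi>: "has_wirtinger \<phi> (\<psi> z) (\<phi>\<^sub>b z) z" if "z \<in> U" for z
  proof -
    have "has_wirtinger \<phi> ((- 1 / 2 * \<phi> z) * P z) ((- 1 / 2 * \<phi> z) * R z) z"
      unfolding \<phi>_def by (rule has_wirtinger_compose[OF W[OF that]]) (auto intro!: derivative_eq_intros)
    then show ?thesis by (simp add: \<psi>_def \<phi>\<^sub>b_def mult_ac)
  qed
  define \<psi>\<^sub>b where "\<psi>\<^sub>b z = - 1 / 2 * (exp (W z) / 2 * \<phi> z + P z * \<phi>\<^sub>b z)" for z
  have \<psi>: "has_wirtinger \<psi> (- 1 / 2 * Q z * \<phi> z) (\<psi>\<^sub>b z) z" if "z \<in> U" for z
  proof -
    have "has_wirtinger \<psi> (- 1 / 2 * (P1 z * \<phi> z + P z * \<psi> z)) (\<psi>\<^sub>b z) z"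
      unfolding \<psi>\<^sub>b_def
      using has_wirtinger_cmult[OF has_wirtinger_mult[OF P[OF that] \<phi>[OF that]], of "- 1 / 2"]
      by (simp add: \<psi>_def[abs_def])
    also have "- 1 / 2 * (P1 z * \<phi> z + P z * \<psi> z) = - 1 / 2 * Q z * \<phi> z"
      by (simp add: \<psi>_def Q_def algebra_simps)
    finally show ?thesis .
  qed
  have \<phi>\<phi>: "\<phi> z * \<phi> z * exp (W z) = 1" for z
    by (simp add: \<phi>_def mult_exp_exp field_simps)
  \<comment> \<open>Cramer's rule for \<open>\<phi> = A f\<^sub>1 + B f\<^sub>2\<close> and \<open>\<phi>_z = A f\<^sub>1' + B f\<^sub>2'\<close>. Since \<open>\<phi>\<close>, \<open>f\<^sub>1\<close> and \<open>f\<^sub>2\<close>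
     solve the same equation in \<open>z\<close>, the \<open>z\<close>-derivatives of \<open>A\<close> and \<open>B\<close> vanish.\<close>
  define A where "A z = \<phi> z * f2' z - \<psi> z * f2 z" for z
  define B where "B z = \<psi> z * f1 z - \<phi> z * f1' z" for z
  define A\<^sub>b where "A\<^sub>b z = \<phi>\<^sub>b z * f2' z - \<psi>\<^sub>b z * f2 z" for z
  define B\<^sub>b where "B\<^sub>b z = \<psi>\<^sub>b z * f1 z - \<phi>\<^sub>b z * f1' z" for z
  have hol: "has_wirtinger f1 (f1' z) 0 z" "has_wirtinger f1' (- 1 / 2 * Q z * f1 z) 0 z"
     "has_wirtinger f2 (f2' z) 0 z" "has_wirtinger f2' (- 1 / 2 * Q z * f2 z) 0 z" if "z \<in> ?disc" for z
    using f1 f2 that by (simp_all add: has_wirtinger_holomorphic)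
  have A: "((\<lambda>z. cnj (A z)) has_field_derivative cnj (A\<^sub>b z)) (at z)" if z: "z \<in> ?disc" for z
  proof -
    have "z \<in> U" using z r by blast
    have "has_wirtinger A 0 (A\<^sub>b z) z"
      using has_wirtinger_diff[OF has_wirtinger_mult[OF \<phi>[OF \<open>z \<in> U\<close>] hol(4)[OF z]]
        has_wirtinger_mult[OF \<psi>[OF \<open>z \<in> U\<close>] hol(3)[OF z]]]
      by (simp add: A_def[abs_def] A\<^sub>b_def algebra_simps)
    from has_wirtinger_cnj[OF this] show ?thesis by (simp add: has_wirtinger_holomorphic)
  qed
  have B: "((\<lambda>z. cnj (B z)) has_field_derivative cnj (B\<^sub>b z)) (at z)" if z: "z \<in> ?disc" for z
  proof -
    have "z \<in> U" using z r by blast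
    have "has_wirtinger B 0 (B\<^sub>b z) z"
      using has_wirtinger_diff[OF has_wirtinger_mult[OF \<psi>[OF \<open>z \<in> U\<close>] hol(1)[OF z]]
        has_wirtinger_mult[OF \<phi>[OF \<open>z \<in> U\<close>] hol(2)[OF z]]]
      by (simp add: B_def[abs_def] B\<^sub>b_def algebra_simps)
    from has_wirtinger_cnj[OF this] show ?thesis by (simp add: has_wirtinger_holomorphic)
  qed
  have decomposition: "A z * f1 z + B z * f2 z = \<phi> z" if "z \<in> ?disc" for z
  proof -
    have "A z * f1 z + B z * f2 z = \<phi> z * (f1 z * f2' z - f1' z * f2 z)"
      by (simp add: A_def B_def algebra_simps)
    then show ?thesis using wronskian[OF that] by simp
  qed
  have anti_wronskian: "A z * B\<^sub>b z - B z * A\<^sub>b z = - 1 / 4" if "z \<in> ?disc" for z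
  proof -
    have "A z * B\<^sub>b z - B z * A\<^sub>b z
        = (\<phi> z * \<psi>\<^sub>b z - \<psi> z * \<phi>\<^sub>b z) * (f1 z * f2' z - f1' z * f2 z)"
      by (simp add: A_def B_def A\<^sub>b_def B\<^sub>b_def algebra_simps)
    also have "\<dots> = \<phi> z * \<psi>\<^sub>b z - \<psi> z * \<phi>\<^sub>b z"
      using wronskian[OF that] by simp
    also have "\<dots> = - 1 / 4 * (\<phi> z * \<phi> z * exp (W z))"
      by (simp add: \<psi>_def \<psi>\<^sub>b_def field_simps)
    finally show ?thesis using \<phi>\<phi> by simp
  qed
  define V where "V = {z \<in> ?disc. f1 z * cnj (A z) \<noteq> 0}"
  have "continuous_on ?disc (\<lambda>z. f1 z * cnj (A z))"
  proof (intro continuous_on_mult)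
    show "continuous_on ?disc f1"
      by (rule DERIV_continuous_on) (rule has_field_derivative_at_within[OF f1(3)])
    show "continuous_on ?disc (\<lambda>z. cnj (A z))"
      by (rule DERIV_continuous_on) (rule has_field_derivative_at_within[OF A])
  qed
  then have "open (?disc \<inter> (\<lambda>z. f1 z * cnj (A z)) -` (- {0}))"
    by (rule continuous_open_preimage) auto
  moreover have "V = ?disc \<inter> (\<lambda>z. f1 z * cnj (A z)) -` (- {0})"
    by (auto simp: V_def)
  ultimately have "open V" by simp
  have V: "z \<in> ?disc" "f1 z \<noteq> 0" "A z \<noteq> 0" if "z \<in> V" for z
    using that by (auto simp: V_def)
  have "p \<in> V" using r f1 f2 by (simp add: V_def A_def \<phi>_def)
  have "V \<subseteq> U" using V(1) r by blast
  define g1 where "g1 z = f2 z / f1 z" for z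
  define g2 where "g2 z = cnj (B z) / cnj (A z)" for z
  have g1: "(g1 has_field_derivative 1 / (f1 z)\<^sup>2) (at z)" if "z \<in> V" for z
  proof -
    note z = V[OF that]
    have "(g1 has_field_derivative (f2' z * f1 z - f2 z * f1' z) / (f1 z * f1 z)) (at z)"
      unfolding g1_def by (rule DERIV_divide[OF f2(3)[OF z(1)] f1(3)[OF z(1)] z(2)])
    also have "f2' z * f1 z - f2 z * f1' z = 1" using wronskian[OF z(1)] by (simp add: mult_ac)
    finally show ?thesis by (simp add: power2_eq_square)
  qed
  have g2: "(g2 has_field_derivative cnj (- 1 / 4 / (A z)\<^sup>2)) (at z)" if "z \<in> V" for z
  proof -
    note z = V[OF that]
    have "(g2 has_field_derivative (cnj (B\<^sub>b z) * cnj (A z) - cnj (B z) * cnj (A\<^sub>b z)) / (cnj (A z) * cnj (A z))) (at z)"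
      unfolding g2_def by (rule DERIV_divide[OF B[OF z(1)] A[OF z(1)]]) (use z in simp)
    also have "cnj (B\<^sub>b z) * cnj (A z) - cnj (B z) * cnj (A\<^sub>b z) = cnj (- 1 / 4)"
      unfolding anti_wronskian[OF z(1), symmetric] by (simp add: mult_ac)
    finally show ?thesis by (simp add: power2_eq_square)
  qed
  have N: "1 + g1 z * cnj (g2 z) = \<phi> z / (A z * f1 z)" if "z \<in> V" for z
    using V[OF that] decomposition[of z] by (simp add: g1_def g2_def field_simps)
  show ?thesis
  proof (rule that[OF \<open>open V\<close> \<open>p \<in> V\<close> \<open>V \<subseteq> U\<close>])
    have "g1 z * cnj (g2 z) \<noteq> - 1" if "z \<in> V" for z
    proof
      assume "g1 z * cnj (g2 z) = - 1"
      with N[OF that] V[OF that] show False by (simp add: \<phi>_def)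
    qed
    moreover have "deriv g1 z * deriv g2 z \<noteq> 0" if "z \<in> V" for z
      unfolding DERIV_imp_deriv[OF g1[OF that]] DERIV_imp_deriv[OF g2[OF that]]
      using V[OF that] by simp
    ultimately show "admissible_on V g1 g2"
      unfolding admissible_on_def holomorphic_on_open[OF \<open>open V\<close>]
      using g1 g2 by blast
  next
    fix z assume "z \<in> V"
    have "alpha g1 g2 z = - 4 * (1 / (f1 z)\<^sup>2) * (- 1 / 4 / (A z)\<^sup>2) / (\<phi> z / (A z * f1 z))\<^sup>2"
      unfolding alpha_def N[OF \<open>z \<in> V\<close>] DERIV_imp_deriv[OF g1[OF \<open>z \<in> V\<close>]]
        DERIV_imp_deriv[OF g2[OF \<open>z \<in> V\<close>]] complex_cnj_cnj ..
    also have "\<dots> = 1 / (\<phi> z * \<phi> z)"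
      using V[OF \<open>z \<in> V\<close>] by (simp add: power_mult_distrib power_divide power2_eq_square)
    also have "\<dots> = exp (W z)"
    proof -
      have "\<phi> z \<noteq> 0" by (simp add: \<phi>_def)
      then show ?thesis using \<phi>\<phi>[of z] by (simp add: divide_eq_eq mult_ac)
    qed
    finally show "alpha g1 g2 z = exp (W z)" .
  qed
qed

section \<open>From solutions to pairs of holomorphic functions\<close>

text \<open>
  Passing from \<open>W = w\<close> to \<open>(K, \<kappa>) = (k, l)\<close> through \<open>K + \<i>\<kappa> = \<bar>e^W\<bar> e^W\<close>: the modulus is
  \<open>e^{2 Re W}\<close>, so the fourth root in the system is \<open>e^{Re W}\<close>.
\<close>

lemma polar_coordinates_of_exp:
  assumes "k = cmod (exp w) * Re (exp w)" "l = cmod (exp w) * Im (exp w)"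
  shows "k\<^sup>2 + l\<^sup>2 = exp (4 * Re w)" and "(k\<^sup>2 + l\<^sup>2) powr (1/4) = exp (Re w)"
    and "is_Arg (Complex k l) (Im w)"
proof -
  have "k\<^sup>2 + l\<^sup>2 = (cmod (exp w))\<^sup>2 * (cmod (exp w))\<^sup>2"
    unfolding assms by (simp only: power_mult_distrib cmod_power2[of "exp w"] distrib_left)
  also have "\<dots> = exp (4 * Re w)"
    by (simp add: power2_eq_square mult_exp_exp)
  finally show kl: "k\<^sup>2 + l\<^sup>2 = exp (4 * Re w)" .
  then show "(k\<^sup>2 + l\<^sup>2) powr (1/4) = exp (Re w)" by (simp add: powr_def)
  have polar: "Complex k l = of_real (cmod (exp w)) * exp w"
    unfolding assms by (simp add: complex_eq_iff)
  have "exp w = exp (of_real (Re w) + \<i> * of_real (Im w))"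
    by (rule arg_cong[OF complex_eq])
  also have "\<dots> = of_real (cmod (exp w)) * exp (\<i> * of_real (Im w))"
    by (simp only: exp_add exp_of_real norm_exp_eq_Re)
  finally have exp_w: "exp w = of_real (cmod (exp w)) * exp (\<i> * of_real (Im w))" .
  have "Complex k l = of_real (cmod (exp w)) * (of_real (cmod (exp w)) * exp (\<i> * of_real (Im w)))"
    unfolding polar by (rule arg_cong[OF exp_w])
  also have "\<dots> = of_real (cmod (Complex k l)) * exp (\<i> * of_real (Im w))"
    unfolding polar by (simp only: norm_mult norm_of_real abs_norm_cancel of_real_mult mult.assoc)
  finally show "is_Arg (Complex k l) (Im w)" unfolding is_Arg_def .
qed

lemma exp_of_polar_coordinates:
  assumes "k\<^sup>2 + l\<^sup>2 = exp (4 * x)" "is_Arg (Complex k l) y"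
  shows "k = cmod (exp (Complex x y)) * Re (exp (Complex x y))"
    and "l = cmod (exp (Complex x y)) * Im (exp (Complex x y))"
proof -
  have "cmod (Complex k l) = sqrt ((exp (2 * x))\<^sup>2)"
    using assms(1) by (simp add: complex_norm power2_eq_square mult_exp_exp)
  then have "cmod (Complex k l) = exp x * exp x" by (simp add: mult_exp_exp)
  then have "Complex k l = of_real (exp x * exp x) * exp (\<i> * of_real y)"
    using assms(2) unfolding is_Arg_def by simp
  also have "\<dots> = of_real (exp x) * exp (Complex x y)"
    by (simp add: Complex_eq exp_add exp_of_real)
  also have "of_real (exp x) = of_real (cmod (exp (Complex x y)))" by simp
  finally have "Complex k l = of_real (cmod (exp (Complex x y))) * exp (Complex x y)" .
  from arg_cong[OF this, of Re] arg_cong[OF this, of Im]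
  show "k = cmod (exp (Complex x y)) * Re (exp (Complex x y))"
    "l = cmod (exp (Complex x y)) * Im (exp (Complex x y))"
    by simp_all
qed

text \<open>
  The branch \<open>Y\<close> of the argument is the imaginary part of \<open>W\<close>, and its real part is the
  logarithm of the fourth root of \<open>K\<^sup>2 + \<kappa>\<^sup>2\<close>. Smoothness of the latter is inherited from the
  holomorphic logarithm, applied to a positive number.
\<close>

lemma solution_imp_local_representation:
  assumes "open D" "solution_on D K \<kappa>" "p \<in> D"
  obtains V g1 g2 where "open V" "p \<in> V" "V \<subseteq> D" "admissible_on V g1 g2"
    "\<And>z. z \<in> V \<Longrightarrow> K z = cmod (alpha g1 g2 z) * Re (alpha g1 g2 z)"
    "\<And>z. z \<in> V \<Longrightarrow> \<kappa> z = cmod (alpha g1 g2 z) * Im (alpha g1 g2 z)"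
proof -
  define m where "m z = (K z)\<^sup>2 + (\<kappa> z)\<^sup>2" for z
  have smooth: "smooth_on D K" "smooth_on D \<kappa>" and nz: "\<And>z. z \<in> D \<Longrightarrow> m z \<noteq> 0"
    and eq1: "\<And>z. z \<in> D \<Longrightarrow> m z powr (1/4) * laplacian (\<lambda>w. ln (m w powr (1/4))) z = 2 * K z"
    using assms(2) unfolding solution_on_def m_def by blast+
  obtain U Y where U: "open U" "p \<in> U" "U \<subseteq> D" "smooth_on U Y"
    and arg: "\<And>z. z \<in> U \<Longrightarrow> is_Arg (Complex (K z) (\<kappa> z)) (Y z)"
    and eq2: "\<And>z. z \<in> U \<Longrightarrow> m z powr (1/4) * laplacian Y z = 2 * \<kappa> z"
  proof -
    have "\<forall>p\<in>D. \<exists>U Y. open U \<and> p \<in> U \<and> U \<subseteq> D \<and> arg_branch_on U K \<kappa> Y \<and>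
        (\<forall>z\<in>U. m z powr (1/4) * laplacian Y z = 2 * \<kappa> z)"
      using assms(2) unfolding solution_on_def m_def by (elim conjE)
    then show ?thesis
      using that assms(3) unfolding arg_branch_on_def by metis
  qed
  have m: "m z > 0" if "z \<in> U" for z
  proof -
    have "m z \<ge> 0" by (simp add: m_def)
    then show ?thesis using nz[of z] that U(3) by force
  qed
  define W where "W z = Complex (1/4 * ln (m z)) (Y z)" for z
  have polar: "K z = cmod (exp (W z)) * Re (exp (W z))" "\<kappa> z = cmod (exp (W z)) * Im (exp (W z))"
    if "z \<in> U" for z
    unfolding W_def using exp_of_polar_coordinates[of "K z" "\<kappa> z" "1/4 * ln (m z)"] arg[OF that] m[OF that]
    by (simp_all add: m_def)
  have root: "m z powr (1/4) = exp (Re (W z))" if "z \<in> U" for z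
    using m[OF that] by (simp add: W_def powr_def)
  have "smooth_on U m"
    unfolding m_def power2_eq_square
    by (intro smooth_on_add smooth_on_mult U smooth_on_subset[OF smooth(1)] smooth_on_subset[OF smooth(2)])
  then have "smooth_on U (\<lambda>z. 1/4 * Ln (of_real (m z)) + \<i> * of_real (Y z))"
    using U(1,4)
    by (intro smooth_on_add smooth_on_mult smooth_on_const
        smooth_on_holomorphic_compose[of U "- \<real>\<^sub>\<le>\<^sub>0" Ln] holomorphic_on_Ln
        smooth_on_linear[OF _ bounded_linear_of_real]) (auto dest: m)
  then have smooth_W: "smooth_on U W"
    by (rule smooth_on_cong[OF U(1), rotated])
       (use m in \<open>simp add: W_def Complex_eq Ln_of_real\<close>)
  obtain P R where "smooth_on U P" and W: "\<And>z. z \<in> U \<Longrightarrow> has_wirtinger W (P z) (R z) z"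
    using smooth_on_imp_has_wirtinger[OF U(1) smooth_W] by metis
  then obtain P1 P2 where "smooth_on U P1"
    and P: "\<And>z. z \<in> U \<Longrightarrow> has_wirtinger P (P1 z) (P2 z) z"
    using smooth_on_imp_has_wirtinger[OF U(1)] by metis
  then have P1: "\<exists>a b. has_wirtinger P1 a b z" if "z \<in> U" for z
    using smooth_on_imp_has_wirtinger[OF U(1)] that by metis
  have P2: "P2 z = exp (W z) / 2" if z: "z \<in> U" for z
  proof -
    have "laplacian (\<lambda>w. ln (m w powr (1/4))) z = 4 * Re (P2 z)"
      by (rule laplacian_smooth_eq(1)[OF U(1) z smooth_W W P[OF z]])
         (simp_all add: root)
    then have "Re (P2 z) = Re (exp (W z) / 2)"
      using eq1[of z] z U(3) root[OF z] polar(1)[OF z] by (auto simp: subset_iff)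
    moreover have "laplacian Y z = 4 * Im (P2 z)"
      by (rule laplacian_smooth_eq(2)[OF U(1) z smooth_W W P[OF z]])
         (simp_all add: W_def)
    then have "Im (P2 z) = Im (exp (W z) / 2)"
      using eq2[of z] z root[OF z] polar(2)[OF z] by auto
    ultimately show ?thesis by (simp add: complex_eq_iff)
  qed
  obtain V g1 g2 where V: "open V" "p \<in> V" "V \<subseteq> U" "admissible_on V g1 g2"
    "\<And>z. z \<in> V \<Longrightarrow> alpha g1 g2 z = exp (W z)"
    using liouville_local_representation[OF U(1,2) W _ P1] P P2 by metis
  show ?thesis
    by (rule that[OF V(1,2) _ V(4)]) (use V U(3) polar in auto)
qed

section \<open>From pairs of holomorphic functions to solutions\<close>

text \<open>
  Dividing by the value \<open>c\<close> at \<open>p\<close> moves \<open>\<alpha>\<close> to \<open>1\<close>, away from the branch cut of \<open>Ln\<close>.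
\<close>

lemma admissible_has_smooth_log_alpha:
  assumes "open D" "admissible_on D g1 g2" "p \<in> D"
  obtains U W where "open U" "p \<in> U" "U \<subseteq> D" "smooth_on U W"
    "\<And>z. z \<in> U \<Longrightarrow> exp (W z) = alpha g1 g2 z"
proof -
  have hol: "g1 holomorphic_on D" "g2 holomorphic_on D"
    and nz: "\<And>z. z \<in> D \<Longrightarrow> deriv g1 z * deriv g2 z \<noteq> 0" "\<And>z. z \<in> D \<Longrightarrow> g1 z * cnj (g2 z) \<noteq> - 1"
    using assms(2) unfolding admissible_on_def by blast+
  have nz': "1 + g1 z * cnj (g2 z) \<noteq> 0" if "z \<in> D" for z
    using nz(2)[OF that] by (metis add.commute add_eq_0_iff)
  have alpha_nz: "alpha g1 g2 z \<noteq> 0" if "z \<in> D" for z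
    using nz(1)[OF that] nz'[OF that] by (simp add: alpha_def)
  have smooth_g: "smooth_on D g1" "smooth_on D (deriv g1)"
      "smooth_on D (\<lambda>z. cnj (g2 z))" "smooth_on D (\<lambda>z. cnj (deriv g2 z))"
    using hol by (simp_all add: smooth_on_holomorphic holomorphic_deriv assms(1)
        smooth_on_linear[OF _ bounded_linear_cnj])
  have "smooth_on D (\<lambda>z. 1 + g1 z * cnj (g2 z))"
    by (intro smooth_on_add smooth_on_mult smooth_on_const assms(1) smooth_g)
  then have "smooth_on D (\<lambda>z. inverse ((1 + g1 z * cnj (g2 z))\<^sup>2))"
    by (intro smooth_on_holomorphic_compose[of D "- {0}" "\<lambda>x. inverse (x\<^sup>2)"] assms(1) holomorphic_intros)
       (use nz' in auto)
  then have "smooth_on D (\<lambda>z. - 4 * deriv g1 z * cnj (deriv g2 z) * inverse ((1 + g1 z * cnj (g2 z))\<^sup>2))"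
    by (intro smooth_on_mult smooth_on_const assms(1) smooth_g)
  then have smooth: "smooth_on D (alpha g1 g2)"
    by (simp add: alpha_def[abs_def] divide_inverse)
  define c where "c = alpha g1 g2 p"
  have "c \<noteq> 0" using alpha_nz assms(3) by (simp add: c_def)
  define T where "T = (\<lambda>x. x / c) -` (- \<real>\<^sub>\<le>\<^sub>0)"
  have "open T"
    unfolding T_def using \<open>c \<noteq> 0\<close>
    by (intro open_vimage continuous_intros) (auto intro: closed_nonpos_Reals_complex)
  define U where "U = D \<inter> alpha g1 g2 -` T"
  have "continuous_on D (alpha g1 g2)"
    using smooth unfolding smooth_on_def by (metis times_differentiable_on.simps(1))
  then have "open U"
    unfolding U_def using assms(1) \<open>open T\<close> by (rule continuous_open_preimage)
  have "p \<in> U" using \<open>c \<noteq> 0\<close> assms(3) by (simp add: U_def T_def c_def)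
  define W where "W z = Ln (alpha g1 g2 z / c) + Ln c" for z
  have "smooth_on U W"
    unfolding W_def
  proof (rule smooth_on_holomorphic_compose[of U T "\<lambda>x. Ln (x / c) + Ln c"])
    show "(\<lambda>x. Ln (x / c) + Ln c) holomorphic_on T"
      using \<open>c \<noteq> 0\<close> by (intro holomorphic_intros) (auto simp: T_def)
    show "smooth_on U (alpha g1 g2)" by (rule smooth_on_subset[OF smooth]) (simp add: U_def)
  qed (use \<open>open T\<close> \<open>open U\<close> in \<open>auto simp: U_def\<close>)
  show ?thesis
    by (rule that[OF \<open>open U\<close> \<open>p \<in> U\<close> _ \<open>smooth_on U W\<close>])
       (use \<open>c \<noteq> 0\<close> alpha_nz in \<open>auto simp: U_def W_def exp_add\<close>)
qed

text \<open>
  Taking \<open>\<partial>_z\<close> of \<open>log \<alpha> = log (-4) + log g\<^sub>1' + log h' - 2 log (1 + g\<^sub>1 h)\<close>, with \<open>h\<close> the conjugate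
  of \<open>g\<^sub>2\<close>, removes the antiholomorphic term \<open>log h'\<close>, and taking \<open>\<partial>_{z'}\<close> afterwards removes the
  holomorphic one. What is left is \<open>- 2 g\<^sub>1' h' / (1 + g\<^sub>1 h)\<^sup>2 = \<alpha> / 2\<close>.
\<close>

lemma log_alpha_liouville:
  assumes "open U" "admissible_on U g1 g2" "\<And>z. z \<in> U \<Longrightarrow> exp (W z) = alpha g1 g2 z"
    and W: "\<And>z. z \<in> U \<Longrightarrow> has_wirtinger W (P z) (R z) z" and "z \<in> U"
  obtains P1 where "has_wirtinger P P1 (exp (W z) / 2) z"
proof -
  have hol: "g1 holomorphic_on U" "g2 holomorphic_on U"
    and nz: "\<And>z. z \<in> U \<Longrightarrow> deriv g1 z * deriv g2 z \<noteq> 0" "\<And>z. z \<in> U \<Longrightarrow> g1 z * cnj (g2 z) \<noteq> - 1"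
    using assms(2) unfolding admissible_on_def by blast+
  define N where "N z = 1 + g1 z * cnj (g2 z)" for z
  have N0: "N z \<noteq> 0" if "z \<in> U" for z
    using nz(2)[OF that] unfolding N_def by (metis add.commute add_eq_0_iff)
  have D0: "has_wirtinger g1 (deriv g1 z) 0 z" "has_wirtinger g2 (deriv g2 z) 0 z"
    "has_wirtinger (deriv g1) (deriv (deriv g1) z) 0 z" "has_wirtinger (deriv g2) (deriv (deriv g2) z) 0 z"
    "has_wirtinger (deriv (deriv g1)) (deriv (deriv (deriv g1)) z) 0 z"
    if "z \<in> U" for z
    unfolding has_wirtinger_holomorphic
    by (intro holomorphic_derivI[OF _ assms(1) that] holomorphic_deriv assms(1) hol)+
  have D1: "has_wirtinger (\<lambda>z. cnj (g2 z)) 0 (cnj (deriv g2 z)) z"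
    "has_wirtinger (\<lambda>z. cnj (deriv g2 z)) 0 (cnj (deriv (deriv g2) z)) z" if "z \<in> U" for z
    using has_wirtinger_cnj[OF D0(2)[OF that]] has_wirtinger_cnj[OF D0(4)[OF that]] by simp_all
  have N: "has_wirtinger N (deriv g1 z * cnj (g2 z)) (g1 z * cnj (deriv g2 z)) z" if "z \<in> U" for z
    unfolding N_def
    using has_wirtinger_add[OF has_wirtinger_const has_wirtinger_mult[OF D0(1)[OF that] D1(1)[OF that]]]
    by simp
  \<comment> \<open>Differentiating \<open>e^W N\<^sup>2 = -4 g\<^sub>1' h'\<close> avoids logarithms and quotients; the equation itself
     then serves to eliminate \<open>h'\<close>.\<close>
  have P_eq: "P z = deriv (deriv g1) z * inverse (deriv g1 z) - 2 * (deriv g1 z * cnj (g2 z) * inverse (N z))"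
    if z: "z \<in> U" for z
  proof -
    have alpha: "exp (W w) * (N w * N w) = - 4 * (deriv g1 w * cnj (deriv g2 w))" if "w \<in> U" for w
      using assms(3)[OF that] N0[OF that] by (simp add: alpha_def N_def power2_eq_square)
    have "has_wirtinger (\<lambda>w. exp (W w)) (exp (W z) * P z) (exp (W z) * R z) z"
      by (rule has_wirtinger_compose[OF W[OF z]]) (rule DERIV_exp)
    from has_wirtinger_mult[OF this has_wirtinger_mult[OF N[OF z] N[OF z]]]
    have "has_wirtinger (\<lambda>w. - 4 * (deriv g1 w * cnj (deriv g2 w)))
       (exp (W z) * P z * (N z * N z) + exp (W z) * (deriv g1 z * cnj (g2 z) * N z + N z * (deriv g1 z * cnj (g2 z))))
       (exp (W z) * R z * (N z * N z) + exp (W z) * (g1 z * cnj (deriv g2 z) * N z + N z * (g1 z * cnj (deriv g2 z)))) z"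
      by (rule has_wirtinger_cong[OF _ assms(1) z alpha])
    from has_wirtinger_unique(1)[OF this has_wirtinger_cmult[OF has_wirtinger_mult[OF D0(3)[OF z] D1(2)[OF z]]]]
    have "exp (W z) * (N z * N z * P z + 2 * (deriv g1 z * cnj (g2 z) * N z))
        = - 4 * (deriv (deriv g1) z * cnj (deriv g2 z))"
      by (simp add: algebra_simps)
    then have "exp (W z) * (N z * N z * P z + 2 * (deriv g1 z * cnj (g2 z) * N z)) * deriv g1 z
        = deriv (deriv g1) z * (- 4 * (deriv g1 z * cnj (deriv g2 z)))"
      by (simp add: mult_ac)
    also have "\<dots> = exp (W z) * (deriv (deriv g1) z * (N z * N z))"
      unfolding alpha[OF z, symmetric] by (simp add: mult_ac)
    finally have "(exp (W z) * N z) * ((N z * P z + 2 * (deriv g1 z * cnj (g2 z))) * deriv g1 z)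
        = (exp (W z) * N z) * (deriv (deriv g1) z * N z)"
      by (simp add: algebra_simps)
    then have "(N z * P z + 2 * (deriv g1 z * cnj (g2 z))) * deriv g1 z = deriv (deriv g1) z * N z"
      using N0[OF z] by (auto simp only: mult_cancel_left mult_eq_0_iff exp_not_eq_zero)
    moreover have "deriv g1 z \<noteq> 0" using nz(1)[OF z] by auto
    ultimately show ?thesis using N0[OF z] by (simp add: field_simps)
  qed
  have inv_N: "has_wirtinger (\<lambda>w. inverse (N w)) (- (inverse (N z))\<^sup>2 * (deriv g1 z * cnj (g2 z)))
      (- (inverse (N z))\<^sup>2 * (g1 z * cnj (deriv g2 z))) z"
    by (rule has_wirtinger_compose[OF N[OF \<open>z \<in> U\<close>]])
       (use DERIV_inverse[OF N0[OF \<open>z \<in> U\<close>]] in \<open>simp add: power2_eq_square power_Suc0_right numeral_2_eq_2\<close>)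
  have inv_g: "has_wirtinger (\<lambda>w. inverse (deriv g1 w)) (- (inverse (deriv g1 z))\<^sup>2 * deriv (deriv g1) z)
      (- (inverse (deriv g1 z))\<^sup>2 * 0) z"
    by (rule has_wirtinger_compose[OF D0(3)[OF \<open>z \<in> U\<close>]])
       (use DERIV_inverse[of "deriv g1 z" UNIV] nz(1)[OF \<open>z \<in> U\<close>] in \<open>simp add: power2_eq_square numeral_2_eq_2\<close>)
  note dP = has_wirtinger_diff[OF has_wirtinger_mult[OF D0(5)[OF \<open>z \<in> U\<close>] inv_g]
      has_wirtinger_cmult[OF has_wirtinger_mult[OF has_wirtinger_mult[OF D0(3)[OF \<open>z \<in> U\<close>] D1(1)[OF \<open>z \<in> U\<close>]] inv_N]]]
  have "exp (W z) / 2 = - (2 * (deriv g1 z * cnj (deriv g2 z) * (N z - g1 z * cnj (g2 z)) * (inverse (N z))\<^sup>2))"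
    using assms(3)[OF \<open>z \<in> U\<close>] N0[OF \<open>z \<in> U\<close>] by (simp add: alpha_def N_def field_simps)
  also have "\<dots> = - (2 * (deriv g1 z * cnj (deriv g2 z) * inverse (N z)
      + deriv g1 z * cnj (g2 z) * (- (inverse (N z))\<^sup>2 * (g1 z * cnj (deriv g2 z)))))"
    using N0[OF \<open>z \<in> U\<close>] by (simp add: field_simps power2_eq_square)
  \<comment> \<open>The shape that the product rules give to the \<open>z'\<close>-derivative of the right-hand side of
     \<open>P_eq\<close>; the zeros are the \<open>z'\<close>-derivatives of the holomorphic factors.\<close>
  also have "\<dots> = 0 * inverse (deriv g1 z) + deriv (deriv g1) z * (- (inverse (deriv g1 z))\<^sup>2 * 0)
      - 2 * ((0 * cnj (g2 z) + deriv g1 z * cnj (deriv g2 z)) * inverse (N z)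
      + deriv g1 z * cnj (g2 z) * (- (inverse (N z))\<^sup>2 * (g1 z * cnj (deriv g2 z))))"
    by simp
  finally have Pzb: "exp (W z) / 2 = \<dots>" .
  show ?thesis
    by (rule that[OF has_wirtinger_cong[OF dP assms(1) \<open>z \<in> U\<close> P_eq[symmetric], folded Pzb]])
qed

text \<open>
  Smoothness is checked locally: on the domain of a logarithm \<open>W\<close> of \<open>\<alpha>\<close>, the functions \<open>K\<close> and
  \<open>\<kappa>\<close> are the real and imaginary part of \<open>exp (Re W + W)\<close>, a composition of smooth functions,
  and \<open>Im W\<close> serves as the branch of the argument.
\<close>

lemma admissible_imp_solution:
  assumes D: "open D" "admissible_on D g1 g2"
  shows "solution_on D (\<lambda>z. cmod (alpha g1 g2 z) * Re (alpha g1 g2 z))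
                       (\<lambda>z. cmod (alpha g1 g2 z) * Im (alpha g1 g2 z))"
proof -
  define K where "K z = cmod (alpha g1 g2 z) * Re (alpha g1 g2 z)" for z
  define \<kappa> where "\<kappa> z = cmod (alpha g1 g2 z) * Im (alpha g1 g2 z)" for z
  define m where "m z = (K z)\<^sup>2 + (\<kappa> z)\<^sup>2" for z
  have local: "\<exists>U Y. open U \<and> p \<in> U \<and> U \<subseteq> D \<and> smooth_on U K \<and> smooth_on U \<kappa> \<and>
      arg_branch_on U K \<kappa> Y \<and>
      (\<forall>z\<in>U. m z \<noteq> 0 \<and> m z powr (1/4) * laplacian (\<lambda>w. ln (m w powr (1/4))) z = 2 * K z \<and>
             m z powr (1/4) * laplacian Y z = 2 * \<kappa> z)" if p: "p \<in> D" for p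
  proof -
    obtain U W where U: "open U" "p \<in> U" "U \<subseteq> D" and W: "smooth_on U W"
      "\<And>z. z \<in> U \<Longrightarrow> exp (W z) = alpha g1 g2 z"
      using admissible_has_smooth_log_alpha[OF D p] by metis
    have K: "K z = cmod (exp (W z)) * Re (exp (W z))" "\<kappa> z = cmod (exp (W z)) * Im (exp (W z))"
      if "z \<in> U" for z
      using W(2)[OF that] by (simp_all add: K_def \<kappa>_def)
    have polar: "m z = exp (4 * Re (W z))" "m z powr (1/4) = exp (Re (W z))"
        "is_Arg (Complex (K z) (\<kappa> z)) (Im (W z))" if "z \<in> U" for z
      unfolding m_def using polar_coordinates_of_exp[OF K[OF that]] by blast+
    have adm: "admissible_on U g1 g2"
      using D(2) U(3) unfolding admissible_on_def by (blast intro: holomorphic_on_subset)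
    define G where "G z = exp (of_real (Re (W z)) + W z)" for z
    have "smooth_on U G"
      unfolding G_def
      by (rule smooth_on_holomorphic_compose[of U UNIV exp])
         (auto intro!: smooth_on_add U W smooth_on_linear[OF _ bounded_linear_of_real]
           smooth_on_linear[OF _ bounded_linear_Re] holomorphic_intros)
    then have "smooth_on U (\<lambda>z. Re (G z))" "smooth_on U (\<lambda>z. Im (G z))"
      by (auto intro: smooth_on_linear bounded_linear_Re bounded_linear_Im U)
    moreover have "Re (G z) = K z" "Im (G z) = \<kappa> z" if "z \<in> U" for z
      unfolding K(1)[OF that] K(2)[OF that] by (simp_all add: G_def exp_add exp_of_real)
    ultimately have "smooth_on U K" "smooth_on U \<kappa>"
      using smooth_on_cong[OF U(1), of "\<lambda>z. Re (G z)" K] smooth_on_cong[OF U(1), of "\<lambda>z. Im (G z)" \<kappa>]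
      by blast+
    moreover have "arg_branch_on U K \<kappa> (\<lambda>z. Im (W z))"
      unfolding arg_branch_on_def using polar(3) smooth_on_linear[OF U(1) bounded_linear_Im W(1)] by blast
    moreover have "m z \<noteq> 0 \<and> m z powr (1/4) * laplacian (\<lambda>w. ln (m w powr (1/4))) z = 2 * K z \<and>
             m z powr (1/4) * laplacian (\<lambda>z. Im (W z)) z = 2 * \<kappa> z" if z: "z \<in> U" for z
    proof -
      obtain P R where P: "\<And>z. z \<in> U \<Longrightarrow> has_wirtinger W (P z) (R z) z"
        using smooth_on_imp_has_wirtinger[OF U(1) W(1)] by metis
      obtain P1 where P1: "has_wirtinger P P1 (exp (W z) / 2) z"
        using log_alpha_liouville[OF U(1) adm W(2) P z] by metis
      have "laplacian (\<lambda>w. ln (m w powr (1/4))) z = 4 * Re (exp (W z) / 2)"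
        by (rule laplacian_smooth_eq(1)[OF U(1) z W(1) P P1]) (simp_all add: polar(2))
      moreover have "laplacian (\<lambda>z. Im (W z)) z = 4 * Im (exp (W z) / 2)"
        by (rule laplacian_smooth_eq(2)[OF U(1) z W(1) P P1]) simp_all
      ultimately show ?thesis
        unfolding K(1)[OF z] K(2)[OF z] polar(2)[OF z] using polar(1)[OF z] by simp
    qed
    ultimately show ?thesis using U by blast
  qed
  have "solution_on D K \<kappa>"
    unfolding solution_on_def m_def[symmetric]
  proof (intro conjI ballI)
    show "smooth_on D K" "smooth_on D \<kappa>" by (rule smooth_on_local, use local in blast)+
  next
    fix z assume "z \<in> D"
    from local[OF this]
    show "m z \<noteq> 0" "m z powr (1/4) * laplacian (\<lambda>w. ln (m w powr (1/4))) z = 2 * K z"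
      by blast+
  next
    fix p assume "p \<in> D"
    from local[OF this]
    show "\<exists>U Y. open U \<and> p \<in> U \<and> U \<subseteq> D \<and> arg_branch_on U K \<kappa> Y \<and>
        (\<forall>z\<in>U. m z powr (1/4) * laplacian Y z = 2 * \<kappa> z)"
      by (elim exE conjE) (intro exI conjI ballI, assumption+, blast)
  qed
  then show ?thesis unfolding K_def[abs_def] \<kappa>_def[abs_def] .
qed

theorem theorem1:
  fixes D :: "complex set"
  assumes "open D" and "connected D"
  shows "(\<forall>K \<kappa>. solution_on D K \<kappa> \<longrightarrow>
            (\<forall>p\<in>D. \<exists>U g1 g2. open U \<and> p \<in> U \<and> U \<subseteq> D \<and> admissible_on U g1 g2 \<and>
               (\<forall>z\<in>U. K z = cmod (alpha g1 g2 z) * Re (alpha g1 g2 z) \<and>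
                      \<kappa> z = cmod (alpha g1 g2 z) * Im (alpha g1 g2 z)))) \<and>
         (\<forall>g1 g2. admissible_on D g1 g2 \<longrightarrow>
            solution_on D (\<lambda>z. cmod (alpha g1 g2 z) * Re (alpha g1 g2 z))
                          (\<lambda>z. cmod (alpha g1 g2 z) * Im (alpha g1 g2 z)))"
proof (intro conjI allI impI ballI)
  fix K \<kappa> p
  assume "solution_on D K \<kappa>" "p \<in> D"
  from solution_imp_local_representation[OF assms(1) this]
  show "\<exists>U g1 g2. open U \<and> p \<in> U \<and> U \<subseteq> D \<and> admissible_on U g1 g2 \<and>
          (\<forall>z\<in>U. K z = cmod (alpha g1 g2 z) * Re (alpha g1 g2 z) \<and>
                 \<kappa> z = cmod (alpha g1 g2 z) * Im (alpha g1 g2 z))"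
    by metis
next
  fix g1 g2
  assume "admissible_on D g1 g2"
  then show "solution_on D (\<lambda>z. cmod (alpha g1 g2 z) * Re (alpha g1 g2 z))
                          (\<lambda>z. cmod (alpha g1 g2 z) * Im (alpha g1 g2 z))"
    by (rule admissible_imp_solution[OF assms(1)])
qed

end
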